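(* Let $n\geq 2$, let $A\in\mathbb{Z}^{m\times n}$ be an integral matrix of full column rank, let $\alpha\in\mathbb{Z}^n\setminus\{0\}$, $b\in\mathbb{Z}^m$ and $c\in\mathbb{Q}^n$. Let $x^*$ be an optimal vertex of the linear program $\max\{c^\top x : Ax\le b,\ x\in\mathbb{R}^n\}$. If the integer program $\max\{c^\top x : Ax\le b,\ x\in\mathbb{Z}^n\}$ is feasible, then it has an optimal solution $z^*$ such that \[ |\alpha^\top(x^*-z^* )|<\frac{4n+2}{9}\cdot\Delta^{\alpha}(A). \]
   Context: For $\alpha\in\mathbb{Z}^n$, $\Delta^{\alpha}(A)$ is the maximum of $\left|\det\begin{pmatrix}\alpha^\top\\ B\end{pmatrix}\right|$ over all $(n-1)\times n$ submatrices $B$ of $A$ (i.e., $B$ consists of $n-1$ rows of $A$). *)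

theory Defs
  imports "HOL-Analysis.Analysis"
begin

text \<open>Delta^alpha(A): maximum of |det [alpha; B]| over all choices B of n-1 rows of A.
  The row of the n x n matrix at index j0 is alpha; the remaining rows are rows f i of A.
  Permuting rows only changes the sign, and repeated row choices give determinant 0,
  so this equals the paper's maximum.\<close>
definition Delta_alpha :: "real^'n \<Rightarrow> real^'n^'m \<Rightarrow> real" where
  "Delta_alpha \<alpha> A =
     Max {\<bar>det (\<chi> i. if i = j0 then \<alpha> else A $ (f i))\<bar> | (j0::'n) (f::'n \<Rightarrow> 'm). True}"

definition polyhedron_of :: "real^'n^'m \<Rightarrow> real^'m \<Rightarrow> (real^'n) set" where
  "polyhedron_of A b = {x. \<forall>i. (A *v x) $ i \<le> b $ i}"

end

theory Submission
  imports Defs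
begin

text \<open>
  Among the optimal integer solutions let \<open>z\<close> minimise the total slack of the constraints that are
  tight at the vertex \<open>xstar\<close>, and let \<open>x = xstar - z\<close>. The spindle of all \<open>w\<close> such that \<open>g \<bullet> w\<close> lies
  between \<open>0\<close> and \<open>g \<bullet> x\<close> for every row \<open>g\<close> of \<open>A\<close> is lattice-free in a strong sense: if \<open>w\<close> lies in
  it, \<open>\<bar>t\<bar> \<le> 1\<close> and all entries of \<open>A y\<close> are less than \<open>1\<close> in absolute value, then \<open>t w + y\<close> is not a
  nonzero integer vector, since by integrality of \<open>A\<close> and \<open>b\<close> it would lead from \<open>z\<close> to a better choice.

  Let \<open>w\<close> be such a vector annihilated by \<open>n - k - 1\<close> independent rows of \<open>A\<close>. Complete \<open>\<alpha>\<close> and these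
  rows by \<open>k\<close> rows of \<open>A\<close> to a matrix with maximal determinant. The coordinates of the rows of \<open>A\<close>
  with respect to these \<open>k\<close> rows form a system in \<open>k\<close>-space all of whose determinants are at most \<open>1\<close>,
  and by a packing argument \<open>\<bar>\<alpha> \<bullet> w\<bar>\<close> times the volume of its polar is less than
  \<open>2 ^ k * Delta_alpha \<alpha> A\<close>. The polar has length at least \<open>2\<close> if \<open>k = 1\<close> and area at least \<open>3\<close> if
  \<open>k = 2\<close>, which bounds \<open>\<bar>\<alpha> \<bullet> w\<bar>\<close> by \<open>1\<close> and \<open>4/3\<close> times \<open>Delta_alpha \<alpha> A\<close>, respectively.

  Finally \<open>x\<close> is a sum of vectors of the spindle as above with \<open>k = 2\<close>, except for one with \<open>k = 1\<close> if
  \<open>n = 3 q + 2\<close> and two with \<open>k = 1\<close> if \<open>n = 3 q + 1\<close>. Adding up gives the bound.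
\<close>

section \<open>Splitting a vector along a spindle\<close>

definition annihilators :: "'a::real_inner set \<Rightarrow> 'a \<Rightarrow> 'a set" where
  "annihilators G w = {g \<in> G. g \<bullet> w = 0}"

text \<open>For \<open>w\<close> in a cone that is bounded by the hyperplanes orthogonal to the elements of \<open>G\<close>, this is the
  dimension of the least face containing \<open>w\<close>.\<close>
definition face_dim :: "'a::euclidean_space set \<Rightarrow> 'a \<Rightarrow> nat" where
  "face_dim G w = DIM('a) - dim (annihilators G w)"

definition spindle :: "'a::real_inner set \<Rightarrow> 'a \<Rightarrow> 'a set" where
  "spindle G x = {y. \<forall>g\<in>G. g \<bullet> y \<in> closed_segment 0 (g \<bullet> x)}"

lemma face_dim_le_iff:
  "face_dim G w \<le> k \<longleftrightarrow> DIM('a) \<le> dim (annihilators G w) + k" for w :: "'a::euclidean_space"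
  by (auto simp: face_dim_def)

lemma annihilators_0 [simp]: "annihilators G 0 = G"
  by (simp add: annihilators_def)

lemma spindle_self: "x \<in> spindle G x"
  by (simp add: spindle_def)

lemma spindle_diff: "w \<in> spindle G x \<Longrightarrow> x - w \<in> spindle G x"
  by (auto simp: spindle_def closed_segment_eq_real_ivl inner_diff_right split: if_splits)

lemma spindle_trans: "y \<in> spindle G w \<Longrightarrow> w \<in> spindle G x \<Longrightarrow> y \<in> spindle G x"
  unfolding spindle_def by (fastforce simp: closed_segment_eq_real_ivl split: if_splits)

lemma annihilators_rescale:
  assumes "\<And>g. g \<in> G \<Longrightarrow> c g \<noteq> 0"
  shows "annihilators ((\<lambda>g. c g *\<^sub>R g) ` G) w = (\<lambda>g. c g *\<^sub>R g) ` annihilators G w"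
  using assms by (auto simp: annihilators_def)

lemma dim_rescale:
  fixes G :: "'a::euclidean_space set"
  assumes "finite G" "\<And>g. g \<in> G \<Longrightarrow> c g \<noteq> 0"
  shows "dim ((\<lambda>g. c g *\<^sub>R g) ` G) = dim G"
  using real_vector.span_image_scale[of G c] assms by (metis dim_span)

lemma dim_Un_uminus:
  fixes S T :: "'a::euclidean_space set"
  shows "dim (S \<union> uminus ` T) = dim (S \<union> T)"
proof -
  have "uminus ` T \<subseteq> span T" by (auto intro: span_neg span_base)
  moreover have "t \<in> span (uminus ` T)" if "t \<in> T" for t
    using span_neg[OF span_base[OF imageI[OF that]]] by (metis minus_minus)
  ultimately have "span (uminus ` T) = span T" by (auto simp: span_eq)
  then have "span (S \<union> uminus ` T) = span (S \<union> T)" by (simp add: span_Un)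
  then show ?thesis by (metis dim_span)
qed

lemma face_dim_rescale:
  assumes "finite G" "\<And>g. g \<in> G \<Longrightarrow> c g \<noteq> 0"
  shows "face_dim ((\<lambda>g. c g *\<^sub>R g) ` G) w = face_dim G w"
proof -
  have "dim ((\<lambda>g. c g *\<^sub>R g) ` annihilators G w) = dim (annihilators G w)"
    using assms by (intro dim_rescale) (auto simp: annihilators_def)
  then show ?thesis using assms(2) by (simp add: face_dim_def annihilators_rescale)
qed

lemma spindle_rescale:
  assumes "\<And>g. g \<in> G \<Longrightarrow> c g \<noteq> 0"
  shows "spindle ((\<lambda>g. c g *\<^sub>R g) ` G) x = spindle G x"
proof -
  have "t * a \<in> closed_segment 0 (t * b) \<longleftrightarrow> a \<in> closed_segment 0 b" if "t \<noteq> 0" for a b t :: real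
    using closed_segment_linear_image[of "(*) t" 0 b] that
    by (simp add: linear_times inj_image_mem_iff inj_on_def)
  then show ?thesis using assms by (auto simp: spindle_def)
qed

lemma dim_insert_not_orthogonal:
  fixes T :: "'a::euclidean_space set"
  assumes "\<And>h. h \<in> T \<Longrightarrow> h \<bullet> e = 0" "g \<bullet> e \<noteq> 0"
  shows "dim (insert g T) = dim T + 1"
proof -
  have "orthogonal e g" if "g \<in> span T"
    using that by (rule orthogonal_to_span) (use assms(1) in \<open>auto simp: orthogonal_def inner_commute\<close>)
  then have "g \<notin> span T" using assms(2) by (auto simp: orthogonal_def inner_commute)
  then show ?thesis by (simp add: dim_insert)
qed

lemma full_dim_inner_eq_0:
  fixes H :: "'a::euclidean_space set"
  assumes "dim H = DIM('a)" "\<And>h. h \<in> H \<Longrightarrow> h \<bullet> e = 0"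
  shows "e = 0"
proof -
  have "e \<in> span H" using assms(1) dim_eq_full by auto
  then have "orthogonal e e"
    by (rule orthogonal_to_span) (use assms(2) in \<open>auto simp: orthogonal_def inner_commute\<close>)
  then show ?thesis by (simp add: orthogonal_def)
qed

lemma dim_Un_submodular:
  fixes S T E :: "'a::euclidean_space set"
  assumes "E \<subseteq> S" "E \<subseteq> T"
  shows "dim (S \<union> T) + dim E \<le> dim S + dim T"
proof -
  have "dim {x + y |x y. x \<in> span S \<and> y \<in> span T} + dim (span S \<inter> span T) = dim (span S) + dim (span T)"
    by (rule dim_sums_Int) auto
  moreover have "{x + y |x y. x \<in> span S \<and> y \<in> span T} = span (S \<union> T)"
    by (auto simp: span_Un)
  moreover have "dim E \<le> dim (span S \<inter> span T)"
    by (rule dim_subset) (use assms span_superset in blast)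
  ultimately show ?thesis by simp
qed

lemma ratio_test:
  fixes p q :: "'i \<Rightarrow> real"
  assumes "finite I" and p: "\<And>i. i \<in> I \<Longrightarrow> 0 \<le> p i"
    and q: "\<And>i. i \<in> I \<Longrightarrow> p i = 0 \<Longrightarrow> 0 \<le> q i"
    and neg: "\<exists>i\<in>I. q i < 0"
  obtains s j where "0 < s" "\<And>i. i \<in> I \<Longrightarrow> 0 \<le> p i + s * q i" "j \<in> I" "q j < 0" "p j + s * q j = 0"
proof -
  let ?N = "{i \<in> I. q i < 0}"
  have "finite ?N" "?N \<noteq> {}" using assms by auto
  then obtain j where j: "j \<in> ?N" and jmin: "\<And>i. i \<in> ?N \<Longrightarrow> p j / (- q j) \<le> p i / (- q i)"
    using ex_is_arg_min_if_finite[of ?N "\<lambda>i. p i / (- q i)"] by (auto simp: is_arg_min_linorder)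
  let ?s = "p j / (- q j)"
  have pj: "p j > 0" using j p[of j] q[of j] by force
  show ?thesis
  proof (rule that[of ?s j])
    show "0 < ?s" using pj j by (auto simp: divide_pos_neg)
    show "0 \<le> p i + ?s * q i" if "i \<in> I" for i
    proof (cases "q i < 0")
      case True
      then have "?s \<le> p i / (- q i)" using jmin that by auto
      then have "?s * (- q i) \<le> p i" using True pos_le_divide_eq[of "- q i" ?s "p i"] by linarith
      then show ?thesis by linarith
    next
      case False
      then have "0 \<le> ?s * q i" using \<open>0 < ?s\<close> by (intro mult_nonneg_nonneg) linarith+
      then show ?thesis using p[OF that] by linarith
    qed
    show "j \<in> I" "q j < 0" "p j + ?s * q j = 0" using j by auto
  qed
qed

lemma face_dim_descent:
  fixes H :: "'a::euclidean_space set"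
  assumes H: "finite H" "dim H = DIM('a)" and d: "\<And>h. h \<in> H \<Longrightarrow> 0 \<le> h \<bullet> d" and "1 < face_dim H d"
  obtains d' where "\<And>h. h \<in> H \<Longrightarrow> 0 \<le> h \<bullet> d'" "f \<bullet> d' = f \<bullet> d" "face_dim H d' < face_dim H d"
proof -
  let ?T = "annihilators H d"
  have "dim (insert f ?T) < DIM('a)" using assms(4) by (auto simp: face_dim_def dim_insert)
  then obtain e0 where "e0 \<noteq> 0" and e0: "\<And>y. y \<in> span (insert f ?T) \<Longrightarrow> orthogonal e0 y"
    using orthogonal_to_subspace_exists by blast
  then obtain h where h: "h \<in> H" "h \<bullet> e0 \<noteq> 0" using full_dim_inner_eq_0[OF H(2)] by blast
  define e where "e = (if h \<bullet> e0 < 0 then e0 else - e0)"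
  have e: "y \<bullet> e = 0" if "y \<in> insert f ?T" for y
    using e0[OF span_base[OF that]] by (auto simp: e_def orthogonal_def inner_commute)
  have "\<exists>h\<in>H. h \<bullet> e < 0" using h by (intro bexI[of _ h]) (auto simp: e_def)
  then obtain s j where s: "0 < s" "\<And>h. h \<in> H \<Longrightarrow> 0 \<le> h \<bullet> d + s * (h \<bullet> e)"
    and j: "j \<in> H" "j \<bullet> e < 0" "j \<bullet> d + s * (j \<bullet> e) = 0"
    by (rule ratio_test[of H "\<lambda>h. h \<bullet> d" "\<lambda>h. h \<bullet> e", rotated 3])
       (use H(1) d e in \<open>auto simp: annihilators_def\<close>)
  show ?thesis
  proof (rule that[of "d + s *\<^sub>R e"])
    show "0 \<le> h \<bullet> (d + s *\<^sub>R e)" if "h \<in> H" for h using s(2)[OF that] by (simp add: inner_add_right)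
    show "f \<bullet> (d + s *\<^sub>R e) = f \<bullet> d" using e by (simp add: inner_add_right)
    have "insert j ?T \<subseteq> annihilators H (d + s *\<^sub>R e)"
      using j e by (auto simp: annihilators_def inner_add_right)
    then have "dim (insert j ?T) \<le> dim (annihilators H (d + s *\<^sub>R e))" by (rule dim_subset)
    moreover have "dim (insert j ?T) = dim ?T + 1"
      by (rule dim_insert_not_orthogonal[of _ e]) (use e j in auto)
    ultimately show "face_dim H (d + s *\<^sub>R e) < face_dim H d"
      using assms(4) by (simp add: face_dim_def)
  qed
qed

lemma improving_extreme_ray:
  fixes H :: "'a::euclidean_space set"
  assumes H: "finite H" "dim H = DIM('a)" and "\<And>h. h \<in> H \<Longrightarrow> 0 \<le> h \<bullet> d0" "f \<bullet> d0 < 0"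
  obtains d where "\<And>h. h \<in> H \<Longrightarrow> 0 \<le> h \<bullet> d" "f \<bullet> d < 0" "face_dim H d \<le> 1"
  using assms(3,4)
proof (induction "face_dim H d0" arbitrary: d0 thesis rule: less_induct)
  case less
  show ?case
  proof (cases "face_dim H d0 \<le> 1")
    case False
    then obtain d' where "\<And>h. h \<in> H \<Longrightarrow> 0 \<le> h \<bullet> d'" "f \<bullet> d' = f \<bullet> d0" "face_dim H d' < face_dim H d0"
      using face_dim_descent[OF H less.prems(2), of f] by auto
    then show ?thesis using less.hyps[of d'] less.prems by auto
  qed (use less.prems in blast)
qed

locale oriented_spindle =
  fixes G :: "'a::euclidean_space set" and x :: 'a
  assumes finite_G: "finite G" and dim_G: "dim G = DIM('a)"
    and nonneg: "g \<in> G \<Longrightarrow> 0 \<le> g \<bullet> x"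
begin

definition vertices :: "'a set" where
  "vertices = {y \<in> spindle G x. dim (annihilators G y \<union> annihilators G (x - y)) = DIM('a)}"

lemma mem_spindle: "y \<in> spindle G x \<longleftrightarrow> (\<forall>g\<in>G. 0 \<le> g \<bullet> y \<and> g \<bullet> y \<le> g \<bullet> x)"
  using nonneg by (auto simp: spindle_def closed_segment_eq_real_ivl)

lemma sum_inner_pos:
  assumes y: "y \<in> spindle G x" and "y \<noteq> 0"
  shows "0 < \<Sum>G \<bullet> y"
proof -
  obtain g where "g \<in> G" "g \<bullet> y \<noteq> 0" using full_dim_inner_eq_0[OF dim_G] \<open>y \<noteq> 0\<close> by blast
  then have "0 < (\<Sum>g\<in>G. g \<bullet> y)" using y finite_G
    by (intro sum_pos2[of _ g]) (auto simp: mem_spindle order_less_le)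
  then show ?thesis by (simp add: inner_sum_left)
qed

lemma finite_vertices: "finite vertices"
proof (rule inj_on_finite)
  let ?tight = "\<lambda>y. (annihilators G y, annihilators G (x - y))"
  show "inj_on ?tight vertices"
  proof (rule inj_onI)
    fix y y' assume "y \<in> vertices" and eq: "?tight y = ?tight y'"
    have "g \<bullet> (y - y') = 0" if "g \<in> annihilators G y \<union> annihilators G (x - y)" for g
    proof -
      have "g \<in> annihilators G y \<inter> annihilators G y' \<union> annihilators G (x - y) \<inter> annihilators G (x - y')"
        using that eq by blast
      then show ?thesis by (auto simp: annihilators_def inner_diff_right)
    qed
    then show "y = y'" using full_dim_inner_eq_0[of _ "y - y'"] \<open>y \<in> vertices\<close>
      by (fastforce simp: vertices_def)
  qed
  show "?tight ` vertices \<subseteq> Pow G \<times> Pow G" by (auto simp: annihilators_def)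
qed (simp add: finite_G)

lemma descending_edge:
  assumes y: "y \<in> vertices" and "y \<noteq> 0"
  obtains d where "\<And>g. g \<in> annihilators G y \<Longrightarrow> 0 \<le> g \<bullet> d"
    "\<And>g. g \<in> annihilators G (x - y) \<Longrightarrow> g \<bullet> d \<le> 0"
    "\<Sum>G \<bullet> d < 0" "face_dim (annihilators G y \<union> annihilators G (x - y)) d \<le> 1"
proof -
  let ?R0 = "annihilators G y" and ?R1 = "annihilators G (x - y)"
  let ?H = "?R0 \<union> uminus ` ?R1"
  have ys: "y \<in> spindle G x" using y by (simp add: vertices_def)
  obtain d where d: "\<And>h. h \<in> ?H \<Longrightarrow> 0 \<le> h \<bullet> d" "\<Sum>G \<bullet> d < 0" "face_dim ?H d \<le> 1"
  proof (rule improving_extreme_ray[of ?H "- y" "\<Sum>G"])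
    show "finite ?H" using finite_G by (simp add: annihilators_def)
    show "dim ?H = DIM('a)" using y by (simp add: vertices_def dim_Un_uminus)
    show "0 \<le> h \<bullet> - y" if "h \<in> ?H" for h using that ys by (auto simp: annihilators_def mem_spindle)
    show "\<Sum>G \<bullet> - y < 0" using sum_inner_pos[OF ys \<open>y \<noteq> 0\<close>] by simp
  qed blast
  show ?thesis
  proof (rule that)
    show "0 \<le> g \<bullet> d" if "g \<in> ?R0" for g using d(1)[of g] that by blast
    show "g \<bullet> d \<le> 0" if "g \<in> ?R1" for g using d(1)[of "- g"] that by auto
    have "annihilators ?H d = annihilators ?R0 d \<union> uminus ` annihilators ?R1 d"
      "annihilators (?R0 \<union> ?R1) d = annihilators ?R0 d \<union> annihilators ?R1 d"
      by (auto simp: annihilators_def)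
    then show "face_dim (?R0 \<union> ?R1) d \<le> 1" using d(3) by (simp add: face_dim_def dim_Un_uminus)
  qed (rule d(2))
qed

lemma edge_endpoint:
  assumes y: "y \<in> spindle G x"
    and d: "\<And>g. g \<in> annihilators G y \<Longrightarrow> 0 \<le> g \<bullet> d" "\<And>g. g \<in> annihilators G (x - y) \<Longrightarrow> g \<bullet> d \<le> 0"
    and descending: "\<Sum>G \<bullet> d < 0" and edge: "face_dim (annihilators G y \<union> annihilators G (x - y)) d \<le> 1"
  obtains s where "0 < s" "y + s *\<^sub>R d \<in> vertices"
proof -
  let ?tight = "\<lambda>y. annihilators G y \<union> annihilators G (x - y)"
  define p where "p = (\<lambda>(g, lower). if lower then g \<bullet> y else g \<bullet> x - g \<bullet> y)"
  define q where "q = (\<lambda>(g, lower). if lower then g \<bullet> d else - (g \<bullet> d))"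
  have "\<exists>g\<in>G. g \<bullet> d < 0"
  proof (rule ccontr)
    assume "\<not> ?thesis"
    then have "0 \<le> (\<Sum>g\<in>G. g \<bullet> d)" by (intro sum_nonneg) auto
    then show False using descending by (simp add: inner_sum_left)
  qed
  then have "\<exists>i\<in>G \<times> {True, False}. q i < 0" by (force simp: q_def)
  then obtain s j where s: "0 < s" "\<And>i. i \<in> G \<times> {True, False} \<Longrightarrow> 0 \<le> p i + s * q i"
    and j: "j \<in> G \<times> {True, False}" "q j < 0" "p j + s * q j = 0"
    by (rule ratio_test[of "G \<times> {True, False}" p q, rotated 3])
       (use finite_G y d in \<open>auto simp: p_def q_def mem_spindle annihilators_def inner_diff_right\<close>)
  let ?y = "y + s *\<^sub>R d"
  have "0 \<le> g \<bullet> ?y \<and> g \<bullet> ?y \<le> g \<bullet> x" if "g \<in> G" for g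
    using s(2)[of "(g, True)"] s(2)[of "(g, False)"] that by (auto simp: p_def q_def inner_add_right)
  then have spindle: "?y \<in> spindle G x" by (simp add: mem_spindle)
  have "fst j \<bullet> d \<noteq> 0" using j(2) by (auto simp: q_def split: prod.splits if_splits)
  moreover have "insert (fst j) (annihilators (?tight y) d) \<subseteq> ?tight ?y"
    using j by (auto simp: p_def q_def annihilators_def inner_add_right inner_diff_right
        split: prod.splits if_splits)
  then have "dim (insert (fst j) (annihilators (?tight y) d)) \<le> dim (?tight ?y)" by (rule dim_subset)
  ultimately have "dim (annihilators (?tight y) d) + 1 \<le> dim (?tight ?y)"
    using dim_insert_not_orthogonal[of "annihilators (?tight y) d" d "fst j"]
    by (simp add: annihilators_def)
  then have "dim (?tight ?y) = DIM('a)"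
    using edge dim_subset_UNIV[of "?tight ?y"] by (simp add: face_dim_le_iff)
  then show ?thesis using that s(1) spindle by (simp add: vertices_def)
qed

lemma face_dim_endpoint_le:
  assumes w: "w \<in> spindle G x"
    and d: "\<And>g. g \<in> annihilators G w \<Longrightarrow> 0 \<le> g \<bullet> d" "\<And>g. g \<in> annihilators G (x - w) \<Longrightarrow> g \<bullet> d \<le> 0"
    and edge: "face_dim (annihilators G w \<union> annihilators G (x - w)) d \<le> 1"
    and dim: "face_dim G x \<le> k + l" "k < face_dim G w"
  shows "face_dim G (x - (w + s *\<^sub>R d)) \<le> l"
proof -
  let ?T0 = "annihilators (annihilators G w) d" and ?T1 = "annihilators (annihilators G (x - w)) d"
  have "g \<bullet> w = 0 \<and> g \<bullet> d = 0" if "g \<in> annihilators G x" for g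
    using that w d[of g] by (fastforce simp: annihilators_def mem_spindle inner_diff_right)
  then have "annihilators G x \<subseteq> ?T0" "annihilators G x \<subseteq> ?T1"
    by (auto simp: annihilators_def inner_diff_right)
  then have "dim (?T0 \<union> ?T1) + dim (annihilators G x) \<le> dim ?T0 + dim ?T1" by (rule dim_Un_submodular)
  moreover have "annihilators (annihilators G w \<union> annihilators G (x - w)) d = ?T0 \<union> ?T1"
    by (auto simp: annihilators_def)
  moreover have "dim ?T0 \<le> dim (annihilators G w)" by (rule dim_subset) (auto simp: annihilators_def)
  ultimately have "DIM('a) \<le> dim ?T1 + l" using edge dim by (simp add: face_dim_le_iff flip: not_le)
  moreover have "dim ?T1 \<le> dim (annihilators G (x - (w + s *\<^sub>R d)))"
    by (rule dim_subset) (auto simp: annihilators_def inner_add_right inner_diff_right)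
  ultimately show ?thesis by (simp add: face_dim_le_iff)
qed

text \<open>Walking down the vertices of the spindle from \<open>x\<close> to \<open>0\<close>, the last one with
  \<open>face_dim G (x - w) \<le> l\<close> is the desired \<open>w\<close>: every edge leaving it has a tight set of corank \<open>1\<close>, so a
  larger face dimension of \<open>w\<close> would allow another step.\<close>
lemma split_at_vertex:
  assumes kl: "face_dim G x \<le> k + l"
  obtains w where "w \<in> spindle G x" "face_dim G w \<le> k" "face_dim G (x - w) \<le> l"
proof -
  let ?W = "{y \<in> vertices. face_dim G (x - y) \<le> l}"
  have "annihilators G x \<union> annihilators G (x - x) = G" by (auto simp: annihilators_def)
  then have "x \<in> ?W" using dim_G by (simp add: vertices_def spindle_self face_dim_def)
  then have "finite ?W" "?W \<noteq> {}" using finite_vertices by auto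
  then obtain w where w: "w \<in> ?W" and lowest: "\<And>y. y \<in> ?W \<Longrightarrow> \<Sum>G \<bullet> w \<le> \<Sum>G \<bullet> y"
    using ex_is_arg_min_if_finite[of ?W "\<lambda>y. \<Sum>G \<bullet> y"] by (auto simp: is_arg_min_linorder)
  have spindle: "w \<in> spindle G x" using w by (simp add: vertices_def)
  have "face_dim G w \<le> k"
  proof (rule ccontr)
    assume neg: "\<not> face_dim G w \<le> k"
    then have "w \<noteq> 0" using dim_G by (auto simp: face_dim_def)
    let ?R0 = "annihilators G w" and ?R1 = "annihilators G (x - w)"
    obtain d where d: "\<And>g. g \<in> ?R0 \<Longrightarrow> 0 \<le> g \<bullet> d" "\<And>g. g \<in> ?R1 \<Longrightarrow> g \<bullet> d \<le> 0"
      "\<Sum>G \<bullet> d < 0" "face_dim (?R0 \<union> ?R1) d \<le> 1"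
      using descending_edge[of w] w \<open>w \<noteq> 0\<close> by blast
    obtain s where s: "0 < s" "w + s *\<^sub>R d \<in> vertices" by (rule edge_endpoint[OF spindle d])
    have "face_dim G (x - (w + s *\<^sub>R d)) \<le> l"
      using face_dim_endpoint_le[OF spindle d(1,2,4) kl] neg by simp
    then have "w + s *\<^sub>R d \<in> ?W" using s(2) by simp
    then have "\<Sum>G \<bullet> w \<le> \<Sum>G \<bullet> (w + s *\<^sub>R d)" by (rule lowest)
    moreover have "s * (\<Sum>G \<bullet> d) < 0" using s(1) d(3) by (simp add: mult_pos_neg)
    ultimately show False by (simp add: inner_add_right)
  qed
  then show ?thesis using that spindle w by blast
qed

end

lemma spindle_split:
  fixes G :: "'a::euclidean_space set"
  assumes G: "finite G" "dim G = DIM('a)" and kl: "face_dim G x \<le> k + l"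
  obtains w where "w \<in> spindle G x" "face_dim G w \<le> k" "face_dim G (x - w) \<le> l"
proof -
  define \<sigma> where "\<sigma> g = (if 0 \<le> g \<bullet> x then 1 else (-1::real))" for g
  let ?G = "(\<lambda>g. \<sigma> g *\<^sub>R g) ` G"
  have \<sigma>: "\<sigma> g \<noteq> 0" for g by (simp add: \<sigma>_def)
  interpret oriented_spindle ?G x
    by standard (use G \<sigma> in \<open>auto simp: \<sigma>_def dim_rescale\<close>)
  have dim: "face_dim ?G w = face_dim G w" for w using G(1) \<sigma> by (rule face_dim_rescale)
  obtain w where "w \<in> spindle ?G x" "face_dim ?G w \<le> k" "face_dim ?G (x - w) \<le> l"
    using split_at_vertex[of k l] kl unfolding dim by blast
  moreover have "spindle ?G x = spindle G x" using \<sigma> by (rule spindle_rescale)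
  ultimately show ?thesis using that unfolding dim by blast
qed

section \<open>Lattice packings\<close>

definition int_lattice :: "(real^'n) set" where
  "int_lattice = {z. \<forall>k. z $ k \<in> \<int>}"

lemma int_lattice_add: "u \<in> int_lattice \<Longrightarrow> v \<in> int_lattice \<Longrightarrow> u + v \<in> int_lattice"
  and int_lattice_diff: "u \<in> int_lattice \<Longrightarrow> v \<in> int_lattice \<Longrightarrow> u - v \<in> int_lattice"
  and int_lattice_uminus: "u \<in> int_lattice \<Longrightarrow> - u \<in> int_lattice"
  by (simp_all add: int_lattice_def)

lemma Ints_inner: "u \<in> int_lattice \<Longrightarrow> v \<in> int_lattice \<Longrightarrow> u \<bullet> v \<in> \<int>"
  by (auto simp: int_lattice_def inner_vec_def intro!: Ints_sum Ints_mult)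

lemma Ints_abs_less_1_eq_0: "x \<in> \<int> \<Longrightarrow> \<bar>x\<bar> < 1 \<Longrightarrow> x = (0::real)"
  by (auto elim!: Ints_cases)

lemma Ints_less_add_1_imp_le: "x \<in> \<int> \<Longrightarrow> y \<in> \<int> \<Longrightarrow> x < y + 1 \<Longrightarrow> x \<le> (y::real)"
  by (auto elim!: Ints_cases)

definition unit_cell :: "(real^'n) set" where
  "unit_cell = {x. \<forall>k. 0 \<le> x $ k \<and> x $ k < 1}"

definition floor_vec :: "real^'n \<Rightarrow> real^'n" where
  "floor_vec x = (\<chi> k. of_int \<lfloor>x $ k\<rfloor>)"

lemma lmeasurable_unit_cell: "(unit_cell :: (real^'n) set) \<in> lmeasurable"
  and measure_unit_cell_le_1: "measure lebesgue (unit_cell :: (real^'n) set) \<le> 1"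
proof -
  have sub: "unit_cell \<subseteq> cbox 0 (\<chi> k. 1 :: real^'n)"
    by (auto simp: unit_cell_def mem_box_cart less_imp_le)
  have "unit_cell = (\<Inter>k. {x :: real^'n. 0 \<le> x $ k} \<inter> {x. x $ k < 1})"
    by (auto simp: unit_cell_def)
  moreover have "(\<Inter>k. {x :: real^'n. 0 \<le> x $ k} \<inter> {x. x $ k < 1}) \<in> sets borel"
    by (intro sets.finite_INT sets.Int borel_closed borel_open closed_Collect_le open_Collect_less
        continuous_intros) auto
  ultimately have "(unit_cell :: (real^'n) set) \<in> sets borel" by simp
  then have meas: "(unit_cell :: (real^'n) set) \<in> sets lebesgue" by (simp add: sets_completionI_sets)
  then show "(unit_cell :: (real^'n) set) \<in> lmeasurable"
    using sub by (intro bounded_set_imp_lmeasurable bounded_subset[OF bounded_cbox])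
  have "measure lebesgue (unit_cell :: (real^'n) set) \<le> measure lebesgue (cbox 0 (\<chi> k. 1 :: real^'n))"
    using sub meas by (rule measure_mono_fmeasurable) simp
  then show "measure lebesgue (unit_cell :: (real^'n) set) \<le> 1"
    by (simp add: content_cbox_if_cart split: if_splits)
qed

lemma mem_translated_unit_cell_iff:
  assumes "z \<in> int_lattice"
  shows "x \<in> (+) z ` unit_cell \<longleftrightarrow> z = floor_vec x"
proof -
  have floor_eq: "r = of_int \<lfloor>s\<rfloor> \<longleftrightarrow> 0 \<le> s - r \<and> s - r < 1" if "r \<in> \<int>" for r s :: real
    using that by (auto elim!: Ints_cases) linarith+
  have "x \<in> (+) z ` unit_cell \<longleftrightarrow> x - z \<in> unit_cell"
    by (auto simp: image_iff algebra_simps intro: bexI[of _ "x - z"])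
  then show ?thesis
    using assms floor_eq by (auto simp: unit_cell_def floor_vec_def int_lattice_def vec_eq_iff)
qed

lemma finite_floor_vec_image:
  assumes "bounded (X :: (real^'n) set)"
  shows "finite (floor_vec ` X)"
proof -
  obtain c where c: "\<And>x. x \<in> X \<Longrightarrow> norm x \<le> c" using assms by (auto simp: bounded_iff)
  let ?I = "{\<lfloor>- c\<rfloor>..\<lfloor>c\<rfloor>}"
  have "\<lfloor>x $ k\<rfloor> \<in> ?I" if "x \<in> X" for x k
    using c[OF that] component_le_norm_cart[of x k] by (auto intro!: floor_mono)
  then have "floor_vec ` X \<subseteq> (\<lambda>f. \<chi> k. of_int (f k)) ` (UNIV \<rightarrow>\<^sub>E ?I)"
    by (intro image_subsetI rev_image_eqI[where x = "\<lambda>k. \<lfloor>_ $ k\<rfloor>"]) (auto simp: floor_vec_def)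
  then show ?thesis by (rule finite_subset) (intro finite_imageI finite_PiE; simp)
qed

lemma measure_eq_sum_unit_cells:
  fixes X :: "(real^'n) set"
  assumes X: "X \<in> lmeasurable" and Z: "finite Z" "Z \<subseteq> int_lattice" "floor_vec ` X \<subseteq> Z"
  shows "measure lebesgue X = (\<Sum>z\<in>Z. measure lebesgue ((+) (- z) ` X \<inter> unit_cell))"
proof -
  have cell: "(+) z ` unit_cell \<in> lmeasurable" for z :: "real^'n"
    by (simp add: lmeasurable_unit_cell measurable_translation)
  have "x \<in> (+) (floor_vec x) ` unit_cell" if "x \<in> X" for x
    using Z that by (subst mem_translated_unit_cell_iff) auto
  then have "X = (\<Union>z\<in>Z. X \<inter> (+) z ` unit_cell)" using Z(3) by blast
  then have "measure lebesgue X = measure lebesgue (\<Union>z\<in>Z. X \<inter> (+) z ` unit_cell)" by simp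
  also have "\<dots> = (\<Sum>z\<in>Z. measure lebesgue (X \<inter> (+) z ` unit_cell))"
  proof (rule measure_UNION'[OF Z(1)])
    show "pairwise (\<lambda>z z'. disjnt (X \<inter> (+) z ` unit_cell) (X \<inter> (+) z' ` unit_cell)) Z"
      unfolding pairwise_def disjnt_iff using Z(2) mem_translated_unit_cell_iff by (metis IntE subsetD)
  qed (use X cell in blast)
  also have "\<dots> = (\<Sum>z\<in>Z. measure lebesgue ((+) (- z) ` X \<inter> unit_cell))"
  proof (intro sum.cong refl)
    fix z :: "real^'n"
    have "(+) (- z) ` (X \<inter> (+) z ` unit_cell) = (+) (- z) ` X \<inter> unit_cell"
      by (auto simp: image_Int image_image)
    then show "measure lebesgue (X \<inter> (+) z ` unit_cell) = measure lebesgue ((+) (- z) ` X \<inter> unit_cell)"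
      using measure_translation[of "- z" "X \<inter> (+) z ` unit_cell"] by simp
  qed
  finally show ?thesis .
qed

lemma lattice_packing_measure_le_1:
  fixes X :: "'i \<Rightarrow> (real^'n) set"
  assumes fin: "finite I" and meas: "\<And>i. i \<in> I \<Longrightarrow> X i \<in> lmeasurable"
    and bdd: "\<And>i. i \<in> I \<Longrightarrow> bounded (X i)"
    and disj: "\<And>i i' z z'. \<lbrakk>i \<in> I; i' \<in> I; z \<in> int_lattice; z' \<in> int_lattice; (i, z) \<noteq> (i', z')\<rbrakk>
       \<Longrightarrow> (+) z ` X i \<inter> (+) z' ` X i' = {}"
  shows "(\<Sum>i\<in>I. measure lebesgue (X i)) \<le> 1"
proof -
  define Z where "Z = floor_vec ` (\<Union>i\<in>I. X i)"
  have Z: "finite Z" unfolding Z_def using fin bdd by (intro finite_floor_vec_image) auto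
  have Z_lattice: "Z \<subseteq> int_lattice" by (auto simp: Z_def floor_vec_def int_lattice_def)
  let ?Y = "\<lambda>(i, z). (+) (- z) ` X i \<inter> unit_cell"
  have Y: "?Y p \<in> lmeasurable" if "p \<in> I \<times> Z" for p
  proof -
    obtain i z where p: "p = (i, z)" "i \<in> I" using \<open>p \<in> I \<times> Z\<close> by blast
    show ?thesis unfolding p(1) prod.case
      by (intro fmeasurable.Int measurable_translation meas p(2) lmeasurable_unit_cell)
  qed
  have "(\<Sum>i\<in>I. measure lebesgue (X i)) = (\<Sum>i\<in>I. \<Sum>z\<in>Z. measure lebesgue (?Y (i, z)))"
    using Z Z_lattice meas unfolding prod.case
    by (intro sum.cong refl measure_eq_sum_unit_cells) (auto simp: Z_def)
  also have "\<dots> = (\<Sum>p\<in>I \<times> Z. measure lebesgue (?Y p))"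
    by (simp add: sum.cartesian_product case_prod_unfold)
  also have "\<dots> = measure lebesgue (\<Union>p\<in>I \<times> Z. ?Y p)"
  proof (rule measure_UNION'[symmetric])
    show "pairwise (\<lambda>p q. disjnt (?Y p) (?Y q)) (I \<times> Z)"
    proof (rule pairwiseI)
      fix p q assume "p \<in> I \<times> Z" "q \<in> I \<times> Z" "p \<noteq> q"
      then obtain i z i' z' where pq: "p = (i, z)" "q = (i', z')" "i \<in> I" "i' \<in> I" "z \<in> Z" "z' \<in> Z"
          "(i, - z) \<noteq> (i', - z')"
        by auto
      have "(+) (- z) ` X i \<inter> (+) (- z') ` X i' = {}"
        using pq Z_lattice by (intro disj int_lattice_uminus) auto
      then show "disjnt (?Y p) (?Y q)" unfolding pq(1,2) prod.case disjnt_def by blast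
    qed
  qed (use fin Z Y in auto)
  also have "\<dots> \<le> measure lebesgue (unit_cell :: (real^'n) set)"
    by (rule measure_mono_fmeasurable[OF _ sets.finite_UN lmeasurable_unit_cell])
       (use fin Z Y in \<open>auto intro: fmeasurableD\<close>)
  finally show ?thesis using measure_unit_cell_le_1[where 'n = 'n] by linarith
qed

lemma lattice_point_in_cylinder:
  fixes Y :: "(real^'n) set" and v :: "real^'n"
  assumes Y: "Y \<in> lmeasurable" "bounded Y" and big: "1 < (real J + 1) * measure lebesgue Y"
  obtains p y y' and j :: int where "p \<in> int_lattice" "\<bar>j\<bar> \<le> int J" "y \<in> Y" "y' \<in> Y"
    "p = of_int j *\<^sub>R v + (y - y')" "(p, j) \<noteq> (0, 0)"
proof -
  let ?X = "\<lambda>i::nat. (+) (real i *\<^sub>R v) ` Y"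
  have "(\<Sum>i\<le>J. measure lebesgue (?X i)) = (real J + 1) * measure lebesgue Y"
    by (simp add: measure_translation)
  then have "\<not> (\<Sum>i\<le>J. measure lebesgue (?X i)) \<le> 1" using big by linarith
  moreover have "?X i \<in> lmeasurable" "bounded (?X i)" for i
    using Y by (auto simp: measurable_translation bounded_translation)
  ultimately obtain i i' z z' where "i \<le> J" "i' \<le> J" and z: "z \<in> int_lattice" "z' \<in> int_lattice"
      and ne: "(i, z) \<noteq> (i', z')" and common: "(+) z ` ?X i \<inter> (+) z' ` ?X i' \<noteq> {}"
    using lattice_packing_measure_le_1[of "{..J}" ?X] unfolding atMost_iff by blast
  then obtain y y' where y: "y \<in> Y" "y' \<in> Y" "z + (real i *\<^sub>R v + y) = z' + (real i' *\<^sub>R v + y')"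
    by auto
  show ?thesis
  proof (rule that[of "z - z'" "int i' - int i" y' y])
    show "z - z' = of_int (int i' - int i) *\<^sub>R v + (y' - y)"
      using y(3) by (simp add: algebra_simps)
    show "(z - z', int i' - int i) \<noteq> (0, 0)" using ne by auto
  qed (use z y \<open>i \<le> J\<close> \<open>i' \<le> J\<close> in \<open>auto simp: int_lattice_diff\<close>)
qed

section \<open>Linear images and prisms\<close>

definition scales_lebesgue :: "(real^'n \<Rightarrow> real^'n) \<Rightarrow> bool" where
  "scales_lebesgue f \<longleftrightarrow> (\<forall>S\<in>lmeasurable.
     f ` S \<in> lmeasurable \<and> measure lebesgue (f ` S) = \<bar>det (matrix f)\<bar> * measure lebesgue S)"

lemma scales_lebesgue_comp:
  assumes "linear f" "linear g" "scales_lebesgue f" "scales_lebesgue g"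
  shows "scales_lebesgue (f \<circ> g)"
proof -
  have "(f \<circ> g) ` S = f ` g ` S" for S by (simp add: image_comp)
  then show ?thesis
    using assms matrix_compose[of g f] by (simp add: scales_lebesgue_def det_mul abs_mult del: o_apply)
qed

lemma scales_lebesgue_not_inj:
  assumes "linear f" "\<not> inj f"
  shows "scales_lebesgue f"
  using assms negligible_linear_singular_image[OF assms] det_nz_iff_inj[OF assms(1)]
  by (simp add: scales_lebesgue_def negligible_iff_measure)

lemma scales_lebesgue_stretch: "scales_lebesgue (\<lambda>x::real^'n. \<chi> i. c i * x $ i)"
proof -
  have "det (matrix (\<lambda>x::real^'n. \<chi> i. c i * x $ i)) = prod c UNIV"
    by (subst det_diagonal) (simp_all add: matrix_def axis_def)
  then show ?thesis by (simp add: scales_lebesgue_def measurable_stretch measure_stretch)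
qed

lemma scales_lebesgue_if_box:
  fixes f :: "real^'n \<Rightarrow> real^'n"
  assumes "linear f" "\<bar>det (matrix f)\<bar> = 1"
    and box: "\<And>a b. cbox a b \<noteq> {} \<Longrightarrow> measure lebesgue (f ` cbox a b) = measure lebesgue (cbox a b)"
  shows "scales_lebesgue f"
proof -
  have "measure lebesgue (f ` cbox a b) = 1 * measure lebesgue (cbox a b)" for a b
    using box[of a b] by (cases "cbox a b = {}") simp_all
  from measure_linear_sufficient[OF assms(1) _ this] show ?thesis
    unfolding scales_lebesgue_def assms(2) by metis
qed

lemma scales_lebesgue_transpose:
  fixes m n :: "'n::finite"
  assumes "m \<noteq> n"
  shows "scales_lebesgue (\<lambda>x. \<chi> i. x $ Transposition.transpose m n i)"
proof (rule scales_lebesgue_if_box)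
  let ?t = "Transposition.transpose m n"
  let ?h = "\<lambda>x::real^'n. \<chi> i. x $ ?t i"
  show "linear ?h" by (rule linearI) (simp_all add: vec_eq_iff)
  have "matrix ?h = (\<chi> i. (mat 1 :: real^'n^'n) $ ?t i)"
    by (simp add: matrix_def mat_def axis_def vec_eq_iff eq_commute)
  then show "\<bar>det (matrix ?h)\<bar> = 1"
    using det_permute_rows[of ?t "mat 1 :: real^'n^'n"] assms
    by (simp add: permutes_swap_id sign_swap_id)
  fix a b :: "real^'n" assume ne: "cbox a b \<noteq> {}"
  have inv: "?h (?h x) = x" for x by (simp add: vec_eq_iff)
  have mem: "x \<in> cbox (?h a) (?h b) \<longleftrightarrow> ?h x \<in> cbox a b" for x
    by (simp add: mem_box_cart) (metis transpose_involutory)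
  have img: "?h ` cbox a b = cbox (?h a) (?h b)"
  proof (intro equalityI image_subsetI subsetI)
    show "?h x \<in> cbox (?h a) (?h b)" if "x \<in> cbox a b" for x unfolding mem inv by (rule that)
    show "x \<in> ?h ` cbox a b" if "x \<in> cbox (?h a) (?h b)" for x
      using that[unfolded mem] by (rule rev_image_eqI) (simp only: inv)
  qed
  then have "cbox (?h a) (?h b) \<noteq> {}" using ne by (metis image_is_empty)
  then have "measure lebesgue (?h ` cbox a b) = (\<Prod>i\<in>UNIV. b $ ?t i - a $ ?t i)"
    by (simp add: img content_cbox_cart)
  also have "\<dots> = (\<Prod>i\<in>UNIV. b $ i - a $ i)"
    using prod.permute[OF permutes_swap_id[of m UNIV n], of "\<lambda>i. b $ i - a $ i"] by (simp add: o_def)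
  finally show "measure lebesgue (?h ` cbox a b) = measure lebesgue (cbox a b)"
    using ne by (simp add: content_cbox_cart)
qed

lemma scales_lebesgue_shear:
  fixes m n :: "'n::finite"
  assumes mn: "m \<noteq> n"
  shows "scales_lebesgue (\<lambda>x. \<chi> i. if i = m then x $ m + x $ n else x $ i)"
proof (rule scales_lebesgue_if_box)
  let ?h = "\<lambda>x::real^'n. \<chi> i. if i = m then x $ m + x $ n else x $ i"
  show lin: "linear ?h" by (rule linearI) (simp_all add: vec_eq_iff algebra_simps)
  have "matrix ?h = (\<chi> i. if i = m then row m (mat 1) + 1 *s row n (mat 1) else row i (mat 1))"
    by (simp add: matrix_def mat_def axis_def row_def vec_eq_iff)
  then show "\<bar>det (matrix ?h)\<bar> = 1"
    using det_row_operation[OF mn, of "mat 1 :: real^'n^'n" 1] by simp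
  fix a b :: "real^'n" assume ne: "cbox a b \<noteq> {}"
  have box: "cbox a b = (+) a ` cbox 0 (b - a)" using cbox_translation[of a 0 "b - a"] by simp
  have "?h ` cbox a b = (+) (?h a) ` ?h ` cbox 0 (b - a)"
    unfolding box image_comp by (intro image_cong refl) (simp add: vec_eq_iff)
  then have "measure lebesgue (?h ` cbox a b) = measure lebesgue (?h ` cbox 0 (b - a))"
    by (simp add: measure_translation)
  also have "\<dots> = measure lebesgue (cbox 0 (b - a))"
    by (rule measure_shear_interval[OF mn]) (use ne box in auto)
  also have "\<dots> = measure lebesgue (cbox a b)" unfolding box by (simp only: measure_translation)
  finally show "measure lebesgue (?h ` cbox a b) = measure lebesgue (cbox a b)" .
qed

text \<open>Unlike \<open>measure_linear_image\<close>, this does not require the index type to be well-ordered.\<close>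
lemma linear_imp_scales_lebesgue:
  fixes f :: "real^'n \<Rightarrow> real^'n"
  assumes "linear f"
  shows "scales_lebesgue f"
proof (rule induct_linear_elementary[OF assms])
  fix f :: "real^'n \<Rightarrow> real^'n" and i assume f: "linear f" "\<And>x. f x $ i = 0"
  then have "\<not> surj f" by (metis axis_nth surjD zero_neq_one)
  then show "scales_lebesgue f" using f linear_injective_imp_surjective scales_lebesgue_not_inj by blast
qed (intro scales_lebesgue_comp scales_lebesgue_stretch scales_lebesgue_transpose scales_lebesgue_shear;
    assumption)+

definition prism :: "('k \<Rightarrow> 'n) \<Rightarrow> (real^'k) set \<Rightarrow> (real^'n) set" where
  "prism \<iota> T = {x. (\<chi> i. x $ \<iota> i) \<in> T \<and> (\<forall>j. j \<notin> range \<iota> \<longrightarrow> 0 < x $ j \<and> x $ j < 1)}"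

lemma bounded_prism:
  fixes \<iota> :: "'k::finite \<Rightarrow> 'n::finite"
  assumes "bounded T"
  shows "bounded (prism \<iota> T)"
proof -
  obtain B where B: "\<And>p. p \<in> T \<Longrightarrow> norm p \<le> B" using assms by (auto simp: bounded_iff)
  have "\<bar>x $ j\<bar> \<le> max B 1" if x: "x \<in> prism \<iota> T" for x j
  proof (cases "j \<in> range \<iota>")
    case True
    then obtain i where "j = \<iota> i" by blast
    then have "\<bar>x $ j\<bar> \<le> norm (\<chi> i. x $ \<iota> i)" using component_le_norm_cart[of "\<chi> i. x $ \<iota> i" i] by simp
    also have "\<dots> \<le> B" using x by (intro B) (simp add: prism_def)
    finally show ?thesis by simp
  qed (use x in \<open>fastforce simp: prism_def\<close>)
  then have "prism \<iota> T \<subseteq> cbox (\<chi> i. - max B 1) (\<chi> i. max B 1)"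
    unfolding mem_box_cart subset_iff vec_lambda_beta by (metis abs_le_iff minus_le_iff)
  then show ?thesis using bounded_cbox bounded_subset by blast
qed

lemma open_prism:
  fixes \<iota> :: "'k::finite \<Rightarrow> 'n::finite"
  assumes "open T"
  shows "open (prism \<iota> T)"
proof -
  have "prism \<iota> T = (\<lambda>x. \<chi> i. x $ \<iota> i) -` T \<inter> (\<Inter>j\<in>-range \<iota>. {x. 0 < x $ j} \<inter> {x. x $ j < 1})"
    by (auto simp: prism_def)
  moreover have "open ((\<lambda>x::real^'n. \<chi> i. x $ \<iota> i) -` T)"
    by (intro open_vimage assms continuous_intros)
  moreover have "open (\<Inter>j\<in>-range \<iota>. {x::real^'n. 0 < x $ j} \<inter> {x. x $ j < 1})"
    by (intro open_INT open_Int open_Collect_less continuous_intros ballI) auto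
  ultimately show ?thesis by auto
qed

lemma lmeasurable_prism: "open T \<Longrightarrow> bounded T \<Longrightarrow> prism \<iota> T \<in> lmeasurable"
  for \<iota> :: "'k::finite \<Rightarrow> 'n::finite"
  by (simp add: bounded_prism lmeasurable_open open_prism)

lemma prod_inner_Basis_cart: "(\<Prod>b\<in>Basis. v \<bullet> b) = (\<Prod>i\<in>UNIV. v $ i)" for v :: "real^'n"
  by (simp add: Basis_vec_def inner_axis UNION_singleton_eq_range prod.reindex axis_eq_axis inj_on_def)

lemma emeasure_lborel_box_cart:
  assumes "\<And>i. l $ i \<le> u $ i"
  shows "emeasure lborel (box l u :: (real^'n) set) = (\<Prod>i\<in>UNIV. u $ i - l $ i)"
  using assms unfolding emeasure_lborel_box_eq prod_inner_Basis_cart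
  by (simp add: Basis_vec_def inner_axis)

lemma emeasure_prism_box:
  fixes \<iota> :: "'k::finite \<Rightarrow> 'n::finite"
  assumes \<iota>: "inj \<iota>" and lu: "\<And>i. l $ i \<le> u $ i"
  shows "emeasure lborel (prism \<iota> (box l u)) = (\<Prod>i\<in>UNIV. u $ i - l $ i)"
proof -
  define ext where "ext c x = (\<chi> j. if j \<in> range \<iota> then x $ inv \<iota> j else c)"
    for c :: real and x :: "real^'k"
  have ext: "ext c x $ \<iota> i = x $ i" "j \<notin> range \<iota> \<Longrightarrow> ext c x $ j = c" for c x i j
    using \<iota> by (auto simp: ext_def)
  have split_index: "(\<forall>j. P j) \<longleftrightarrow> (\<forall>i. P (\<iota> i)) \<and> (\<forall>j. j \<notin> range \<iota> \<longrightarrow> P j)" for P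
    by (metis rangeE)
  have "x \<in> prism \<iota> (box l u) \<longleftrightarrow> x \<in> box (ext 0 l) (ext 1 u)" for x
    unfolding mem_box_cart by (subst split_index) (simp add: prism_def mem_box_cart ext)
  then have "prism \<iota> (box l u) = box (ext 0 l) (ext 1 u)" by blast
  moreover have "ext 0 l $ j \<le> ext 1 u $ j" for j using lu by (simp add: ext_def)
  ultimately have "emeasure lborel (prism \<iota> (box l u)) = (\<Prod>j\<in>UNIV. ext 1 u $ j - ext 0 l $ j)"
    by (simp add: emeasure_lborel_box_cart)
  also have "(\<Prod>j\<in>UNIV. ext 1 u $ j - ext 0 l $ j) = (\<Prod>j\<in>range \<iota>. ext 1 u $ j - ext 0 l $ j)"
    using ext(2) by (intro prod.mono_neutral_right) auto
  also have "\<dots> = (\<Prod>i\<in>UNIV. u $ i - l $ i)"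
    using \<iota> by (simp add: prod.reindex ext(1))
  finally show ?thesis .
qed

lemma measure_prism:
  fixes \<iota> :: "'k::finite \<Rightarrow> 'n::finite"
  assumes \<iota>: "inj \<iota>" and T: "open T"
  shows "measure lebesgue (prism \<iota> T) = measure lebesgue T"
proof -
  let ?proj = "\<lambda>x::real^'n. \<chi> i. x $ \<iota> i :: real^'k"
  define M where "M = distr (restrict_space lborel (prism \<iota> UNIV)) borel ?proj"
  have meas: "?proj \<in> borel_measurable (restrict_space lborel (prism \<iota> UNIV))"
    by (intro measurable_restrict_space1)
       (auto intro!: borel_measurable_continuous_onI continuous_intros)
  have "?proj -` S \<inter> prism \<iota> UNIV = prism \<iota> S" "prism \<iota> S \<subseteq> prism \<iota> UNIV" for S
    by (auto simp: prism_def)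
  then have M: "emeasure M S = emeasure lborel (prism \<iota> S)" if "open S" for S
    using that meas open_prism[of UNIV \<iota>] open_prism[OF that, of \<iota>]
    by (simp add: M_def emeasure_distr space_restrict_space emeasure_restrict_space)
  have "lborel = M"
  proof (rule lborel_eqI)
    fix l u :: "real^'k" assume "\<And>b. b \<in> Basis \<Longrightarrow> l \<bullet> b \<le> u \<bullet> b"
    then have lu: "l $ i \<le> u $ i" for i by (simp add: cart_eq_inner_axis axis_in_Basis_iff)
    show "emeasure M (box l u) = (\<Prod>b\<in>Basis. (u - l) \<bullet> b)"
      by (simp add: prod_inner_Basis_cart M[OF open_box] emeasure_prism_box[OF \<iota> lu])
  qed (simp add: M_def)
  then have "emeasure lborel T = emeasure lborel (prism \<iota> T)" using M[OF T] by simp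
  then show ?thesis using T open_prism[OF T, of \<iota>] by (simp add: measure_def)
qed

section \<open>The polar of a system with bounded determinants\<close>

definition open_polar :: "'a::real_inner set \<Rightarrow> 'a set" where
  "open_polar G = {y. \<forall>g\<in>G. g \<bullet> y < 1}"

definition closed_polar :: "'a::real_inner set \<Rightarrow> 'a set" where
  "closed_polar G = {y. \<forall>g\<in>G. g \<bullet> y \<le> 1}"

definition det_bounded_system :: "(real^'k) set \<Rightarrow> bool" where
  "det_bounded_system G \<longleftrightarrow> finite G \<and> (\<forall>g\<in>G. - g \<in> G) \<and> (\<forall>i. axis i 1 \<in> G)
     \<and> (\<forall>M. (\<forall>i. M $ i \<in> G) \<longrightarrow> det M \<le> 1)"

lemma open_open_polar: "finite G \<Longrightarrow> open (open_polar G)"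
proof -
  have "open_polar G = (\<Inter>g\<in>G. {y. g \<bullet> y < 1})" by (auto simp: open_polar_def)
  then show "finite G \<Longrightarrow> open (open_polar G)" by (auto intro!: open_Collect_less continuous_intros)
qed

lemma bounded_open_polar:
  fixes G :: "(real^'k) set"
  assumes "det_bounded_system G"
  shows "bounded (open_polar G)"
proof -
  have "\<bar>y $ i\<bar> \<le> 1" if "y \<in> open_polar G" for y i
  proof -
    have "axis i 1 \<bullet> y < 1" "- axis i 1 \<bullet> y < 1"
      using assms that unfolding det_bounded_system_def open_polar_def by blast+
    then show ?thesis by (simp add: inner_axis')
  qed
  then have "open_polar G \<subseteq> cbox (\<chi> i. - 1) (\<chi> i. 1)"
    by (fastforce simp: mem_box_cart abs_le_iff)
  then show ?thesis using bounded_cbox bounded_subset by blast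
qed

definition symmetrized :: "'a::uminus set \<Rightarrow> 'a set" where
  "symmetrized S = S \<union> uminus ` S"

lemma det_bounded_system_symmetrized:
  fixes \<kappa> :: "'m::finite \<Rightarrow> real^'k"
  assumes axis: "\<And>i. axis i 1 \<in> range \<kappa>" and det: "\<And>g. \<bar>det (\<chi> i. \<kappa> (g i))\<bar> \<le> 1"
  shows "det_bounded_system (symmetrized (range \<kappa>))"
proof -
  have "det M \<le> 1" if "\<And>i. M $ i \<in> symmetrized (range \<kappa>)" for M :: "real^'k^'k"
  proof -
    have "\<exists>s k. \<bar>s\<bar> = 1 \<and> M $ i = s *s \<kappa> k" for i
      using that[of i] by (force simp: symmetrized_def vec_eq_iff intro: exI[of _ 1] exI[of _ "- 1"])
    then obtain s g where s: "\<And>i. \<bar>s i\<bar> = (1::real)" and M: "\<And>i. M $ i = s i *s \<kappa> (g i)" by metis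
    have "M = (\<chi> i. s i *s \<kappa> (g i))" by (simp add: vec_eq_iff M)
    then have "\<bar>det M\<bar> = \<bar>det (\<chi> i. \<kappa> (g i))\<bar>" by (simp add: det_rows_mul abs_mult abs_prod s)
    then show ?thesis using det[of g] by linarith
  qed
  then show ?thesis using axis by (auto simp: det_bounded_system_def symmetrized_def)
qed

lemma inner_diff_half_open_polar_less_1:
  assumes y: "y \<in> (*\<^sub>R) (1 / 2) ` open_polar (symmetrized S)"
      "y' \<in> (*\<^sub>R) (1 / 2) ` open_polar (symmetrized S)"
    and "s \<in> S"
  shows "\<bar>s \<bullet> (y - y')\<bar> < 1"
proof -
  have "\<bar>s \<bullet> z\<bar> < 1" if "z \<in> open_polar (symmetrized S)" for z
  proof -
    have "s \<in> symmetrized S" "- s \<in> symmetrized S" using \<open>s \<in> S\<close> by (auto simp: symmetrized_def)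
    then have "s \<bullet> z < 1" "- s \<bullet> z < 1" using that unfolding open_polar_def by blast+
    then show ?thesis by (simp add: abs_less_iff)
  qed
  then have half: "\<bar>s \<bullet> z\<bar> < 1 / 2" if "z \<in> (*\<^sub>R) (1 / 2) ` open_polar (symmetrized S)" for z
    using that by (auto simp: abs_mult)
  show ?thesis using half[OF y(1)] half[OF y(2)] unfolding inner_diff_right by linarith
qed

lemma measure_open_polar_ge_2:
  fixes G :: "(real^1) set"
  assumes G: "det_bounded_system G"
  shows "2 \<le> measure lebesgue (open_polar G)"
proof -
  have bound: "g $ 1 \<le> 1 \<and> - g $ 1 \<le> 1" if "g \<in> G" for g
  proof -
    have "det (\<chi> i::1. g) \<le> 1" "det (\<chi> i::1. - g) \<le> 1"
      using G that unfolding det_bounded_system_def by auto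
    then show ?thesis by (simp add: det_1)
  qed
  have "box (\<chi> i. - 1) (\<chi> i. 1) \<subseteq> open_polar G"
  proof (clarsimp simp: open_polar_def mem_box_cart inner_vec_def)
    fix y :: "real^1" and g assume y: "- 1 < y $ 1" "y $ 1 < 1" and "g \<in> G"
    have "g $ 1 * y $ 1 \<le> \<bar>g $ 1\<bar> * \<bar>y $ 1\<bar>" by (simp flip: abs_mult)
    also have "\<dots> \<le> 1 * \<bar>y $ 1\<bar>" using bound[OF \<open>g \<in> G\<close>] by (intro mult_right_mono) auto
    also have "\<dots> < 1" using y by auto
    finally show "g $ 1 * y $ 1 < 1" .
  qed
  then have "measure lebesgue (box (\<chi> i. - 1) (\<chi> i. 1 :: real^1)) \<le> measure lebesgue (open_polar G)"
    using G bounded_open_polar[OF G]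
    by (intro measure_mono_fmeasurable)
       (auto intro!: lmeasurable_open open_open_polar simp: det_bounded_system_def)
  then show ?thesis by (simp add: measure_lborel_box_eq Basis_vec_def inner_axis)
qed

definition cross2 :: "real^2 \<Rightarrow> real^2 \<Rightarrow> real" where
  "cross2 P Q = P $ 1 * Q $ 2 - P $ 2 * Q $ 1"

definition rot2 :: "real^2 \<Rightarrow> real^2" where
  "rot2 P = vector [- P $ 2, P $ 1]"

definition sector :: "real^2 \<Rightarrow> real^2 \<Rightarrow> (real^2) set" where
  "sector P Q = {y. 0 < cross2 P y \<and> 0 < cross2 y Q}"

definition quadrant :: "(real^2) set" where
  "quadrant = {y. 0 \<le> y $ 1 \<and> 0 \<le> y $ 2}"

lemma inner2: "P \<bullet> Q = P $ 1 * Q $ 1 + P $ 2 * Q $ 2" for P Q :: "real^2"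
  by (simp add: inner_vec_def sum_2)

lemma rot2_nth [simp]: "rot2 P $ 1 = - P $ 2" "rot2 P $ 2 = P $ 1"
  by (simp_all add: rot2_def)

lemma cross2_scale_left: "cross2 (c *\<^sub>R P) Q = c * cross2 P Q"
  and cross2_scale_right: "cross2 P (c *\<^sub>R Q) = c * cross2 P Q"
  and cross2_self: "cross2 P P = 0"
  and cross2_swap: "cross2 Q P = - cross2 P Q"
  and cross2_rot2: "cross2 (rot2 P) (rot2 Q) = cross2 P Q"
  and inner_rot2: "P \<bullet> rot2 Q = cross2 Q P"
  by (simp_all add: cross2_def inner2 algebra_simps)

lemma cross2_expansion: "cross2 P Q *\<^sub>R R = cross2 R Q *\<^sub>R P + cross2 P R *\<^sub>R Q"
  by (simp add: vec_eq_iff forall_2 cross2_def algebra_simps)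

lemma open_sector: "open (sector P Q)"
  unfolding sector_def cross2_def
  by (intro open_Collect_conj open_Collect_less continuous_intros)

lemma sector_disjoint: "sector P Q \<inter> sector Q R = {}"
proof -
  have "\<not> (0 < cross2 y Q \<and> 0 < cross2 Q y)" for y using cross2_swap[of Q y] by linarith
  then show ?thesis by (auto simp: sector_def)
qed

lemma sector_mono:
  assumes "0 \<le> cross2 P Q" "0 \<le> cross2 Q R" "0 < cross2 P R"
  shows "sector P Q \<subseteq> sector P R" "sector Q R \<subseteq> sector P R"
proof -
  show "sector P Q \<subseteq> sector P R"
  proof
    fix y assume y: "y \<in> sector P Q"
    have "cross2 P Q * cross2 y R = cross2 y Q * cross2 P R + cross2 P y * cross2 Q R"
      by (simp add: cross2_def algebra_simps)
    moreover have "0 < cross2 y Q * cross2 P R" "0 \<le> cross2 P y * cross2 Q R"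
      using y assms by (auto simp: sector_def)
    ultimately have "0 < cross2 P Q * cross2 y R" by linarith
    then have "0 < cross2 y R" using assms(1) by (auto simp: zero_less_mult_iff)
    then show "y \<in> sector P R" using y by (simp add: sector_def)
  qed
  show "sector Q R \<subseteq> sector P R"
  proof
    fix y assume y: "y \<in> sector Q R"
    have "cross2 Q R * cross2 P y = cross2 y R * cross2 P Q + cross2 Q y * cross2 P R"
      by (simp add: cross2_def algebra_simps)
    moreover have "0 \<le> cross2 y R * cross2 P Q" "0 < cross2 Q y * cross2 P R"
      using y assms by (auto simp: sector_def)
    ultimately have "0 < cross2 Q R * cross2 P y" by linarith
    then have "0 < cross2 P y" using assms(2) by (auto simp: zero_less_mult_iff)
    then show "y \<in> sector P R" using y by (simp add: sector_def)
  qed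
qed

lemma quadrant_between:
  assumes "0 \<le> cross2 P R" "0 \<le> cross2 R Q" "0 < cross2 P Q" "P \<in> quadrant" "Q \<in> quadrant"
  shows "R \<in> quadrant"
proof -
  have "0 \<le> cross2 P Q * R $ i" if "0 \<le> P $ i" "0 \<le> Q $ i" for i
    using arg_cong[OF cross2_expansion[of P Q R], of "\<lambda>v. v $ i"] assms(1,2) that by simp
  then show ?thesis using assms(3-) by (simp add: quadrant_def zero_le_mult_iff)
qed

lemma tangent_step:
  assumes "u \<bullet> P = 1" "u \<bullet> Q = 1"
  shows "Q = P + cross2 P Q *\<^sub>R rot2 u"
  using assms unfolding vec_eq_iff forall_2 cross2_def inner2 by simp algebra

lemma measure_interior_triangle:
  "measure lebesgue (interior (convex hull {0, P, Q})) = \<bar>cross2 P Q\<bar> / 2"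
proof -
  let ?T = "convex hull {0, P, Q}"
  have T: "bounded ?T" "closed ?T"
    by (simp_all add: bounded_convex_hull compact_imp_closed finite_imp_compact_convex_hull)
  have "measure lebesgue (interior ?T) = measure lebesgue ?T"
    by (intro measure_interior T(1) negligible_convex_frontier convex_convex_hull)
  also have "\<dots> = measure lborel ?T" using T(2) by simp
  also have "\<dots> = \<bar>cross2 P Q\<bar> / 2"
    unfolding content_triangle by (simp add: cross2_def abs_minus_commute mult.commute)
  finally show ?thesis .
qed

lemma measure_disjoint_Un_le:
  assumes "S \<union> S' \<subseteq> T" "S \<inter> S' = {}" "open S" "open S'" "T \<in> lmeasurable"
  shows "measure lebesgue S + measure lebesgue S' \<le> measure lebesgue T"
proof -
  have meas: "S \<in> lmeasurable" "S' \<in> lmeasurable"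
    using assms by (auto intro: fmeasurableI2[OF assms(5)])
  then have "measure lebesgue S + measure lebesgue S' = measure lebesgue (S \<union> S')"
    using measure_Un3[OF meas] assms(2) by simp
  also have "\<dots> \<le> measure lebesgue T"
    by (rule measure_mono_fmeasurable[OF assms(1) _ assms(5)]) (use meas in auto)
  finally show ?thesis .
qed

text \<open>With \<open>P\<close> on the boundary of the polygon \<open>closed_polar G\<close> and \<open>u \<in> G\<close> tight at \<open>P\<close>, move the pair
  \<open>(P, u)\<close> along the boundary, alternately sliding \<open>P\<close> along an edge and turning \<open>u\<close> at a vertex. The
  potential grows by at most twice the area swept by \<open>P\<close> and by \<open>rot2 u\<close> together, because
  \<open>x + y - x * y \<le> 1\<close> for \<open>x, y \<le> 1\<close>. If the lines of \<open>u\<close> and \<open>u'\<close> meet outside the polygon, the element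
  of \<open>G\<close> most violated there splits the sector.\<close>
definition potential :: "real^2 \<Rightarrow> real^2 \<Rightarrow> real" where
  "potential P u = u $ 2 - u $ 1 + P $ 2 - P $ 1 + u $ 1 * P $ 1"

lemma potential_commute: "potential P u = potential u P"
  by (simp add: potential_def)

lemma potential_step_le:
  assumes "u \<bullet> P = 1" "u \<bullet> Q = 1" "0 \<le> cross2 P Q" "u $ 1 \<le> 1" "u $ 2 \<le> 1"
  shows "potential Q u - potential P u \<le> cross2 P Q"
proof -
  have Q: "Q $ 1 = P $ 1 - cross2 P Q * u $ 2" "Q $ 2 = P $ 2 + cross2 P Q * u $ 1"
    using arg_cong[OF tangent_step[OF assms(1,2)], of "\<lambda>v. v $ _"] by simp_all
  have "potential Q u - potential P u = cross2 P Q * (u $ 1 + u $ 2 - u $ 1 * u $ 2)"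
    unfolding potential_def Q by (simp add: algebra_simps)
  also have "\<dots> = cross2 P Q - cross2 P Q * ((1 - u $ 1) * (1 - u $ 2))" by (simp add: algebra_simps)
  also have "\<dots> \<le> cross2 P Q" using assms(3-) by simp
  finally show ?thesis .
qed

locale planar_system =
  fixes G :: "(real^2) set"
  assumes system: "det_bounded_system G"
begin

definition area :: "(real^2) set \<Rightarrow> real" where
  "area S = measure lebesgue (open_polar G \<inter> S)"

definition contact :: "real^2 \<Rightarrow> real^2 \<Rightarrow> bool" where
  "contact P u \<longleftrightarrow> P \<in> closed_polar G \<inter> quadrant \<and> u \<in> G \<inter> quadrant \<and> u \<bullet> P = 1"

lemma finite_G: "finite G"
  and minus_mem: "g \<in> G \<Longrightarrow> - g \<in> G"
  and axis_mem: "axis i 1 \<in> G"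
  using system by (simp_all add: det_bounded_system_def)

lemma cross2_le_1:
  assumes "g \<in> G" "h \<in> G"
  shows "cross2 g h \<le> 1"
proof -
  have "det (vector [g, h]) \<le> 1"
    using system assms unfolding det_bounded_system_def by (simp add: forall_2)
  then show ?thesis by (simp add: det_2 cross2_def mult.commute)
qed

lemma rot2_mem_closed_polar: "g \<in> G \<Longrightarrow> rot2 g \<in> closed_polar G"
  by (simp add: closed_polar_def inner_rot2 cross2_le_1)

lemma nth_le_1: "g \<in> G \<Longrightarrow> g $ 1 \<le> 1" "g \<in> G \<Longrightarrow> g $ 2 \<le> 1"
  using cross2_le_1[of g "axis 2 1"] cross2_le_1[of "axis 1 1" g] axis_mem
  by (simp_all add: cross2_def axis_def)

lemma closed_polar_nth_le_1: "P \<in> closed_polar G \<Longrightarrow> P $ 1 \<le> 1" "P \<in> closed_polar G \<Longrightarrow> P $ 2 \<le> 1"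
  using axis_mem[of 1] axis_mem[of 2] by (auto simp: closed_polar_def inner2 axis_def)

lemma area_superadditive:
  assumes "S \<union> S' \<subseteq> T" "S \<inter> S' = {}" "open S" "open S'" "open T"
  shows "area S + area S' \<le> area T"
  unfolding area_def using assms bounded_open_polar[OF system] open_open_polar[OF finite_G]
  by (intro measure_disjoint_Un_le) (auto intro: lmeasurable_open bounded_subset)

lemma area_sectors_le:
  assumes "0 \<le> cross2 P Q" "0 \<le> cross2 Q R" "0 < cross2 P R"
  shows "area (sector P Q) + area (sector Q R) \<le> area (sector P R)"
  using sector_mono[OF assms] by (intro area_superadditive sector_disjoint open_sector) blast

lemma cross2_le_area_sector:
  assumes P: "P \<in> closed_polar G" and Q: "Q \<in> closed_polar G"
  shows "cross2 P Q \<le> 2 * area (sector P Q)"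
proof (cases "0 < cross2 P Q")
  case True
  let ?T = "convex hull {0, P, Q}"
  have halfspace: "interior ?T \<subseteq> {y. a \<bullet> y < c}"
    if "a \<noteq> 0" "0 \<le> c" "a \<bullet> P \<le> c" "a \<bullet> Q \<le> c" for a c
  proof -
    have "?T \<subseteq> {y. a \<bullet> y \<le> c}" using that by (intro hull_minimal convex_halfspace_le) auto
    from interior_mono[OF this] show ?thesis using that(1) by simp
  qed
  have "interior ?T \<subseteq> open_polar G"
  proof -
    have "g \<bullet> y < 1" if "g \<in> G" "y \<in> interior ?T" for g y
    proof (cases "g = 0")
      case False
      then show ?thesis using halfspace[of g 1] that P Q by (auto simp: closed_polar_def)
    qed simp
    then show ?thesis by (auto simp: open_polar_def)
  qed
  moreover have "interior ?T \<subseteq> sector P Q"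
  proof -
    have "rot2 P \<noteq> 0" "rot2 Q \<noteq> 0" using True by (auto simp: vec_eq_iff forall_2 cross2_def)
    moreover have "- rot2 P \<bullet> y = - cross2 P y" "rot2 Q \<bullet> y = - cross2 y Q" for y
      by (simp_all add: inner2 cross2_def)
    ultimately show ?thesis
      using halfspace[of "- rot2 P" 0] halfspace[of "rot2 Q" 0] True
      by (auto simp: sector_def cross2_self cross2_swap[of Q P])
  qed
  ultimately have "measure lebesgue (interior ?T) \<le> area (sector P Q)"
    unfolding area_def using bounded_open_polar[OF system] open_open_polar[OF finite_G] open_sector
    by (intro measure_mono_fmeasurable lmeasurable_open) (auto intro: bounded_subset)
  then show ?thesis using True by (simp add: measure_interior_triangle)
next
  case False
  moreover have "0 \<le> area (sector P Q)" by (simp add: area_def)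
  ultimately show ?thesis by linarith
qed

lemma contacts_meet:
  assumes P: "contact P u" and P': "contact P' u'" and uu': "0 < cross2 u u'"
  obtains Q where "u \<bullet> Q = 1" "u' \<bullet> Q = 1" "0 \<le> cross2 P Q" "0 \<le> cross2 Q P'"
proof -
  define Q where "Q = (1 / cross2 u u') *\<^sub>R rot2 (u - u')"
  have "cross2 (u - u') u = cross2 u u'" "cross2 (u - u') u' = cross2 u u'"
    by (simp_all add: cross2_def algebra_simps)
  then have Q: "u \<bullet> Q = 1" "u' \<bullet> Q = 1" using uu' by (simp_all add: Q_def inner_rot2)
  have "u' \<bullet> Q = u' \<bullet> P + cross2 P Q * cross2 u u'" "u \<bullet> P' = u \<bullet> Q + cross2 Q P' * cross2 u' u"
    using P P' tangent_step[of u P Q] tangent_step[of u' Q P'] Q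
    by (metis contact_def inner_add_right inner_rot2 inner_scaleR_right)+
  moreover have "u' \<bullet> P \<le> 1" "u \<bullet> P' \<le> 1" using P P' by (auto simp: contact_def closed_polar_def)
  ultimately have "0 \<le> cross2 P Q * cross2 u u'" "0 \<le> cross2 Q P' * cross2 u u'"
    using Q by (simp_all add: cross2_swap[of u' u])
  then show ?thesis using that Q uu' by (simp add: zero_le_mult_iff)
qed

lemma potential_diff_le_if_meet_in_polar:
  assumes P: "contact P u" and P': "contact P' u'" and uu': "0 < cross2 u u'" and PP': "0 < cross2 P P'"
    and Q: "u \<bullet> Q = 1" "u' \<bullet> Q = 1" "0 \<le> cross2 P Q" "0 \<le> cross2 Q P'" "Q \<in> closed_polar G"
  shows "potential P' u' - potential P u \<le> 2 * area (sector P P') + 2 * area (sector (rot2 u) (rot2 u'))"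
proof -
  note contact = P[unfolded contact_def] P'[unfolded contact_def]
  have "potential Q u - potential P u \<le> cross2 P Q"
    using contact Q nth_le_1 by (intro potential_step_le) auto
  moreover have "potential u' Q - potential u Q \<le> cross2 u u'"
    using Q uu' closed_polar_nth_le_1 by (intro potential_step_le) (auto simp: inner_commute)
  moreover have "potential P' u' - potential Q u' \<le> cross2 Q P'"
    using contact Q nth_le_1 by (intro potential_step_le) auto
  moreover have "cross2 P Q \<le> 2 * area (sector P Q)" "cross2 Q P' \<le> 2 * area (sector Q P')"
    using contact Q by (auto intro: cross2_le_area_sector)
  moreover have "cross2 u u' \<le> 2 * area (sector (rot2 u) (rot2 u'))"
    using contact cross2_le_area_sector[of "rot2 u" "rot2 u'"]
    by (simp add: rot2_mem_closed_polar cross2_rot2)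
  ultimately show ?thesis
    using area_sectors_le[OF Q(3,4) PP'] by (simp add: potential_commute[of Q])
qed

lemma contact_between:
  assumes P: "contact P u" and P': "contact P' u'" and uu': "0 < cross2 u u'" and PP': "0 < cross2 P P'"
    and Q: "u \<bullet> Q = 1" "u' \<bullet> Q = 1" "0 \<le> cross2 P Q" "0 \<le> cross2 Q P'" "Q \<notin> closed_polar G"
  obtains R w where "contact R w" "0 < cross2 u w" "0 < cross2 w u'" "0 < cross2 P R" "0 < cross2 R P'"
proof -
  note contact = P[unfolded contact_def] P'[unfolded contact_def]
  obtain w where w: "w \<in> G" "\<And>g. g \<in> G \<Longrightarrow> g \<bullet> Q \<le> w \<bullet> Q"
    using ex_is_arg_min_if_finite[OF finite_G, of "\<lambda>g. - (g \<bullet> Q)"] axis_mem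
    by (auto simp: is_arg_min_linorder)
  then have wQ: "1 < w \<bullet> Q" using Q(5) by (force simp: closed_polar_def not_le)
  have "w \<bullet> Q = w \<bullet> P + cross2 P Q * cross2 u w"
    by (subst tangent_step[of u P Q]) (use contact Q in \<open>auto simp: inner_add_right inner_rot2\<close>)
  moreover have "w \<bullet> P \<le> 1" "w \<bullet> P' \<le> 1" using contact w(1) by (auto simp: closed_polar_def)
  ultimately have "0 < cross2 P Q * cross2 u w" using wQ by linarith
  then have P_Q: "0 < cross2 P Q" and uw: "0 < cross2 u w" using Q(3) by (auto simp: zero_less_mult_iff)
  have "w \<bullet> P' = w \<bullet> Q + cross2 Q P' * cross2 u' w"
    by (subst tangent_step[of u' Q P']) (use contact Q in \<open>auto simp: inner_add_right inner_rot2\<close>)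
  then have "0 < cross2 Q P' * cross2 w u'"
    using wQ \<open>w \<bullet> P' \<le> 1\<close> by (simp add: cross2_swap[of w u'])
  then have Q_P': "0 < cross2 Q P'" and wu': "0 < cross2 w u'"
    using Q(4) by (auto simp: zero_less_mult_iff)
  define R where "R = (1 / (w \<bullet> Q)) *\<^sub>R Q"
  have "R \<in> closed_polar G" "w \<bullet> R = 1" using w wQ by (auto simp: closed_polar_def R_def)
  moreover have PR: "0 < cross2 P R" and RP': "0 < cross2 R P'"
    using P_Q Q_P' wQ by (simp_all add: R_def cross2_scale_left cross2_scale_right)
  moreover have "R \<in> quadrant" "w \<in> quadrant"
    using contact PR RP' PP' uw wu' uu' by (auto intro: quadrant_between less_imp_le)
  ultimately show ?thesis using that w(1) uw wu' by (simp add: contact_def)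
qed

lemma potential_diff_le:
  assumes "contact P u" "contact P' u'" "0 < cross2 u u'" "0 < cross2 P P'"
  shows "potential P' u' - potential P u \<le> 2 * area (sector P P') + 2 * area (sector (rot2 u) (rot2 u'))"
  using assms
proof (induction "card (G \<inter> sector u u')" arbitrary: P u P' u' rule: less_induct)
  case less
  note uu' = less.prems(3) and PP' = less.prems(4)
  obtain Q where Q: "u \<bullet> Q = 1" "u' \<bullet> Q = 1" "0 \<le> cross2 P Q" "0 \<le> cross2 Q P'"
    using contacts_meet[OF less.prems(1,2) uu'] .
  show ?case
  proof (cases "Q \<in> closed_polar G")
    case True
    then show ?thesis using potential_diff_le_if_meet_in_polar less.prems Q by blast
  next
    case False
    then obtain R w where Rw: "contact R w" and w: "0 < cross2 u w" "0 < cross2 w u'"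
      and R: "0 < cross2 P R" "0 < cross2 R P'"
      using contact_between[OF less.prems Q] by blast
    have "w \<in> G \<inter> sector u u'" using Rw w by (simp add: contact_def sector_def)
    moreover have "w \<notin> sector u w" "w \<notin> sector w u'" by (simp_all add: sector_def cross2_self)
    ultimately have "G \<inter> sector u w \<subset> G \<inter> sector u u'" "G \<inter> sector w u' \<subset> G \<inter> sector u u'"
      using sector_mono[of u w u'] w uu' by auto
    then have smaller: "card (G \<inter> sector u w) < card (G \<inter> sector u u')"
        "card (G \<inter> sector w u') < card (G \<inter> sector u u')"
      using finite_G by (auto intro: psubset_card_mono)
    have "potential R w - potential P u \<le> 2 * area (sector P R) + 2 * area (sector (rot2 u) (rot2 w))"
      by (rule less.hyps[OF smaller(1) less.prems(1) Rw w(1) R(1)])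
    moreover have "potential P' u' - potential R w
        \<le> 2 * area (sector R P') + 2 * area (sector (rot2 w) (rot2 u'))"
      by (rule less.hyps[OF smaller(2) Rw less.prems(2) w(2) R(2)])
    moreover have "area (sector P R) + area (sector R P') \<le> area (sector P P')"
      using R PP' by (intro area_sectors_le) auto
    moreover have "area (sector (rot2 u) (rot2 w)) + area (sector (rot2 w) (rot2 u'))
        \<le> area (sector (rot2 u) (rot2 u'))"
      using w uu' by (intro area_sectors_le) (auto simp: cross2_rot2)
    ultimately show ?thesis by linarith
  qed
qed

lemma area_halfplane_ge: "3 / 2 \<le> area {y. 0 < y $ 2}"
proof -
  let ?e1 = "axis 1 1 :: real^2" and ?e2 = "axis 2 1 :: real^2"
  have "contact ?e1 ?e1" "contact ?e2 ?e2"
    using axis_mem nth_le_1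
    by (auto simp: contact_def closed_polar_def quadrant_def inner2 axis_def)
  then have "potential ?e2 ?e2 - potential ?e1 ?e1
      \<le> 2 * area (sector ?e1 ?e2) + 2 * area (sector (rot2 ?e1) (rot2 ?e2))"
    by (rule potential_diff_le) (simp_all add: cross2_def axis_def)
  moreover have "potential ?e2 ?e2 - potential ?e1 ?e1 = 3" by (simp add: potential_def axis_def)
  moreover have "area (sector ?e1 ?e2) + area (sector (rot2 ?e1) (rot2 ?e2)) \<le> area {y. 0 < y $ 2}"
    by (intro area_superadditive open_sector open_Collect_less continuous_intros)
       (auto simp: sector_def cross2_def axis_def)
  ultimately show ?thesis by linarith
qed

end

lemma measure_open_polar_ge_3:
  fixes G :: "(real^2) set"
  assumes "det_bounded_system G"
  shows "3 \<le> measure lebesgue (open_polar G)"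
proof -
  interpret planar_system G by standard (rule assms)
  have "uminus ` (open_polar G \<inter> {y. 0 < y $ 2}) = open_polar G \<inter> {y. y $ 2 < 0}"
  proof -
    have "- y \<in> open_polar G" if "y \<in> open_polar G" for y
    proof -
      have "- g \<bullet> y < 1" if "g \<in> G" for g
        using \<open>y \<in> open_polar G\<close> minus_mem[OF that] unfolding open_polar_def by blast
      then show ?thesis by (simp add: open_polar_def)
    qed
    then show ?thesis by (auto intro!: image_eqI[of _ uminus "- _"])
  qed
  then have "area {y. y $ 2 < 0} = area {y. 0 < y $ 2}"
    using measure_lebesgue_affine[of "- 1" 0 "open_polar G \<inter> {y. 0 < y $ 2}"] by (simp add: area_def)
  moreover have "area {y. 0 < y $ 2} + area {y. y $ 2 < 0} \<le> area UNIV"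
    by (intro area_superadditive open_Collect_less continuous_intros) auto
  ultimately show ?thesis using area_halfplane_ge by (simp add: area_def)
qed

section \<open>Frames of rows\<close>

lemma rows_eq_range: "rows A = range (($) A)"
  by (auto simp: rows_def row_def)

lemma matrix_inv_inverse:
  assumes "invertible M"
  shows "M ** matrix_inv M = mat 1" "matrix_inv M ** M = mat 1"
  using someI_ex[OF assms[unfolded invertible_def]] by (simp_all add: matrix_inv_def)

lemma sum_permutes_range:
  fixes \<iota> :: "'k::finite \<Rightarrow> 'n"
  assumes \<iota>: "inj \<iota>"
  shows "(\<Sum>p | p permutes range \<iota>. F p) = (\<Sum>q | q permutes UNIV. F (map_permutation UNIV \<iota> q))"
proof (rule sum.reindex_bij_witness[of _ "map_permutation UNIV \<iota>" "map_permutation (range \<iota>) (inv \<iota>)"])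
  have bij: "bij_betw \<iota> UNIV (range \<iota>)" using \<iota> by (simp add: bij_betw_def)
  then have bij_inv: "bij_betw (inv \<iota>) (range \<iota>) UNIV" by (rule bij_betw_inv_into)
  show "map_permutation UNIV \<iota> q \<in> {p. p permutes range \<iota>}" if "q \<in> {q. q permutes UNIV}" for q
    using that map_permutation_permutes[OF bij] by simp
  show "map_permutation (range \<iota>) (inv \<iota>) (map_permutation UNIV \<iota> q) = q"
    if "q \<in> {q. q permutes UNIV}" for q
    using that \<iota> by (intro map_permutation_compose_inv[OF bij]) auto
  show "map_permutation (range \<iota>) (inv \<iota>) p \<in> {q. q permutes UNIV}"
    if "p \<in> {p. p permutes range \<iota>}" for p
    using that map_permutation_permutes[OF bij_inv] by simp
  show lift: "map_permutation UNIV \<iota> (map_permutation (range \<iota>) (inv \<iota>) p) = p"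
    if "p \<in> {p. p permutes range \<iota>}" for p
    using that by (intro map_permutation_compose_inv[OF bij_inv]) (auto intro: f_inv_into_f)
  show "F (map_permutation UNIV \<iota> (map_permutation (range \<iota>) (inv \<iota>) p)) = F p"
    if "p \<in> {p. p permutes range \<iota>}" for p
    by (simp only: lift[OF that])
qed

lemma det_block_identity:
  fixes B :: "real^'n^'n" and \<iota> :: "'k::finite \<Rightarrow> 'n"
  assumes \<iota>: "inj \<iota>" and id: "\<And>r. r \<notin> range \<iota> \<Longrightarrow> B $ r = axis r 1"
  shows "det B = det (\<chi> i j. B $ \<iota> i $ \<iota> j)"
proof -
  let ?lift = "map_permutation UNIV \<iota>"
  have "det B = (\<Sum>p | p permutes range \<iota>. of_int (sign p) * (\<Prod>r\<in>UNIV. B $ r $ p r))"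
    unfolding det_def
  proof (rule sum.mono_neutral_right)
    show "\<forall>p\<in>{p. p permutes UNIV} - {p. p permutes range \<iota>}.
        of_int (sign p) * (\<Prod>r\<in>UNIV. B $ r $ p r) = 0"
    proof
      fix p assume p: "p \<in> {p. p permutes UNIV} - {p. p permutes range \<iota>}"
      then obtain r where "r \<notin> range \<iota>" "p r \<noteq> r" by (auto simp: permutes_def)
      then have "B $ r $ p r = 0" by (simp add: id axis_def)
      then show "of_int (sign p) * (\<Prod>r\<in>UNIV. B $ r $ p r) = 0" by (simp add: prod_zero_iff) blast
    qed
  qed (auto simp: finite_permutations permutes_def)
  also have "\<dots> = (\<Sum>q | q permutes UNIV. of_int (sign (?lift q)) * (\<Prod>r\<in>UNIV. B $ r $ ?lift q r))"
    using \<iota> by (rule sum_permutes_range)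
  also have "\<dots> = (\<Sum>q | q permutes UNIV. of_int (sign q) * (\<Prod>i\<in>UNIV. B $ \<iota> i $ \<iota> (q i)))"
  proof (intro sum.cong refl)
    fix q :: "'k \<Rightarrow> 'k" assume "q \<in> {q. q permutes UNIV}"
    then have "sign (?lift q) = sign q" using \<iota> by (intro sign_map_permutation) auto
    moreover have "?lift q r = r" if "r \<notin> range \<iota>" for r using that by (simp add: map_permutation_def)
    then have "(\<Prod>r\<in>UNIV. B $ r $ ?lift q r) = (\<Prod>r\<in>range \<iota>. B $ r $ ?lift q r)"
      using id by (intro prod.mono_neutral_right) (auto simp: axis_def)
    then have "(\<Prod>r\<in>UNIV. B $ r $ ?lift q r) = (\<Prod>i\<in>UNIV. B $ \<iota> i $ \<iota> (q i))"
      using \<iota> by (simp add: prod.reindex map_permutation_apply)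
    ultimately show "of_int (sign (?lift q)) * (\<Prod>r\<in>UNIV. B $ r $ ?lift q r)
        = of_int (sign q) * (\<Prod>i\<in>UNIV. B $ \<iota> i $ \<iota> (q i))"
      by simp
  qed
  finally show ?thesis by (simp add: det_def)
qed

lemma det_nonzero_if_span_rows:
  fixes M :: "real^'n^'n"
  assumes "span (rows M) = UNIV"
  shows "det M \<noteq> 0"
  using assms
  by (simp add: invertible_det_nz[symmetric] invertible_left_inverse matrix_left_invertible_span_rows)

lemma bij_betw_matching_subsets:
  assumes "finite A" "finite B" "card A = card B" "A' \<subseteq> A" "B' \<subseteq> B" "card A' = card B'"
  obtains h where "bij_betw h A B" "h ` A' = B'"
proof -
  obtain h1 where h1: "bij_betw h1 A' B'"
    using finite_same_card_bij[of A' B'] assms finite_subset by metis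
  obtain h2 where h2: "bij_betw h2 (A - A') (B - B')"
    using finite_same_card_bij[of "A - A'" "B - B'"] assms by (auto simp: card_Diff_subset finite_subset)
  let ?h = "\<lambda>a. if a \<in> A' then h1 a else h2 a"
  have "bij_betw ?h A' B'" using h1 by (subst bij_betw_cong[where g = h1]) auto
  moreover have "bij_betw ?h (A - A') (B - B')" using h2 by (subst bij_betw_cong[where g = h2]) auto
  ultimately have "bij_betw ?h (A' \<union> (A - A')) (B' \<union> (B - B'))" by (rule bij_betw_combine) auto
  moreover have "?h ` A' = B'" using h1 by (auto simp: bij_betw_def)
  ultimately show ?thesis using that assms(4,5) by (simp add: Un_absorb1)
qed

lemma extend_annihilators_to_basis:
  fixes S :: "'a::euclidean_space set"
  assumes S: "dim S = DIM('a)" and \<alpha>: "\<alpha> \<bullet> w \<noteq> 0" and B0: "B0 \<subseteq> annihilators S w" "independent B0"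
  obtains B where "insert \<alpha> B0 \<subseteq> B" "B \<subseteq> insert \<alpha> S" "independent B" "span B = UNIV"
proof -
  have "orthogonal w \<alpha>" if "\<alpha> \<in> span B0"
    using that
    by (rule orthogonal_to_span)
       (use B0(1) in \<open>auto simp: annihilators_def orthogonal_def inner_commute\<close>)
  then have "\<alpha> \<notin> span B0" using \<alpha> by (auto simp: orthogonal_def inner_commute)
  then have "independent (insert \<alpha> B0)" using B0(2) by (rule independent_insertI)
  moreover have "insert \<alpha> B0 \<subseteq> insert \<alpha> S" using B0(1) by (auto simp: annihilators_def)
  ultimately obtain B where B: "insert \<alpha> B0 \<subseteq> B" "B \<subseteq> insert \<alpha> S" "independent B" "insert \<alpha> S \<subseteq> span B"
    by (metis maximal_independent_subset_extend)
  have "span S = UNIV" using S dim_eq_full by auto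
  moreover have "span S \<subseteq> span B" using B(4) by (intro span_minimal) auto
  ultimately have "span B = UNIV" by blast
  then show ?thesis by (rule that[OF B(1-3)])
qed

lemma independent_subset_with_card:
  fixes S :: "'a::euclidean_space set"
  assumes "k \<le> dim S"
  obtains B where "B \<subseteq> S" "independent B" "card B = k"
proof -
  obtain B' where B': "B' \<subseteq> S" "independent B'" "card B' = dim S" by (metis basis_exists)
  then obtain B where "B \<subseteq> B'" "card B = k" using assms by (metis obtain_subset_with_card_n)
  then show ?thesis using that B' independent_mono by blast
qed

lemma matrix_inv_image_lebesgue:
  fixes M :: "real^'n^'n"
  assumes det: "det M \<noteq> 0" and S: "S \<in> lmeasurable"
  shows "(*v) (matrix_inv M) ` S \<in> lmeasurable"
    and "measure lebesgue ((*v) (matrix_inv M) ` S) = measure lebesgue S / \<bar>det M\<bar>"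
proof -
  have "matrix_inv M ** M = mat 1" using det by (simp add: matrix_inv_inverse invertible_det_nz)
  then have "\<bar>det (matrix_inv M)\<bar> * \<bar>det M\<bar> = 1" by (metis abs_mult abs_one det_I det_mul)
  then have "\<bar>det (matrix_inv M)\<bar> = 1 / \<bar>det M\<bar>" using det by (simp add: field_simps)
  then show "(*v) (matrix_inv M) ` S \<in> lmeasurable"
    "measure lebesgue ((*v) (matrix_inv M) ` S) = measure lebesgue S / \<bar>det M\<bar>"
    using linear_imp_scales_lebesgue[OF matrix_vector_mul_linear[of "matrix_inv M"]] S
    by (simp_all add: scales_lebesgue_def matrix_of_matrix_vector_mul)
qed

locale frames =
  fixes A :: "real^'n^'m" and \<alpha> :: "real^'n"
begin

definition frame :: "'n \<Rightarrow> ('n \<Rightarrow> 'm) \<Rightarrow> real^'n^'n" where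
  "frame j0 f = (\<chi> i. if i = j0 then \<alpha> else A $ f i)"

definition row_coords :: "'n \<Rightarrow> ('n \<Rightarrow> 'm) \<Rightarrow> real^'n^'m" where
  "row_coords j0 f = A ** matrix_inv (frame j0 f)"

definition row_coords_on :: "('k::finite \<Rightarrow> 'n) \<Rightarrow> 'n \<Rightarrow> ('n \<Rightarrow> 'm) \<Rightarrow> 'm \<Rightarrow> real^'k" where
  "row_coords_on \<iota> j0 f k = (\<chi> i. row_coords j0 f $ k $ \<iota> i)"

lemma abs_det_frame_le_Delta_alpha: "\<bar>det (frame j0 f)\<bar> \<le> Delta_alpha \<alpha> A"
proof -
  let ?S = "{\<bar>det (\<chi> i. if i = j0 then \<alpha> else A $ (f i))\<bar> | (j0::'n) (f::'n \<Rightarrow> 'm). True}"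
  have "?S = (\<lambda>(j0, f). \<bar>det (\<chi> i. if i = j0 then \<alpha> else A $ (f i))\<bar>) ` UNIV" by auto
  then have "finite ?S" by simp
  then show ?thesis unfolding Delta_alpha_def frame_def by (intro Max_ge) auto
qed

lemma matrix_inv_frame:
  assumes "det (frame j0 f) \<noteq> 0"
  shows "frame j0 f ** matrix_inv (frame j0 f) = mat 1" "matrix_inv (frame j0 f) ** frame j0 f = mat 1"
  using assms by (simp_all add: matrix_inv_inverse invertible_det_nz)

lemma row_coords_frame_row:
  assumes "det (frame j0 f) \<noteq> 0" "i \<noteq> j0"
  shows "row_coords j0 f $ f i $ j = (if i = j then 1 else 0)"
proof -
  have "row_coords j0 f $ f i $ j = (frame j0 f ** matrix_inv (frame j0 f)) $ i $ j"
    using assms(2) by (simp add: row_coords_def matrix_matrix_mult_def frame_def)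
  then show ?thesis using assms(1) by (simp add: matrix_inv_frame mat_def)
qed

lemma frame_row_inner_matrix_inv:
  assumes "det (frame j0 f) \<noteq> 0"
  shows "frame j0 f $ i \<bullet> (matrix_inv (frame j0 f) *v v) = v $ i"
  using assms
  by (simp add: matrix_vector_mul_assoc matrix_inv_frame flip: matrix_vector_mul_component)

lemma row_inner_matrix_inv_frame:
  assumes \<iota>: "inj \<iota>" and v: "\<And>i. i \<notin> range \<iota> \<Longrightarrow> v $ i = 0"
  shows "A $ k \<bullet> (matrix_inv (frame j0 f) *v v) = row_coords_on \<iota> j0 f k \<bullet> (\<chi> i. v $ \<iota> i)"
proof -
  have "A $ k \<bullet> (matrix_inv (frame j0 f) *v v) = (row_coords j0 f *v v) $ k"
    by (simp add: row_coords_def matrix_vector_mul_assoc flip: matrix_vector_mul_component)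
  also have "\<dots> = (\<Sum>i\<in>UNIV. row_coords j0 f $ k $ i * v $ i)" by (simp add: matrix_vector_mult_def)
  also have "\<dots> = (\<Sum>i\<in>range \<iota>. row_coords j0 f $ k $ i * v $ i)"
    by (rule sum.mono_neutral_right) (use v in auto)
  also have "\<dots> = row_coords_on \<iota> j0 f k \<bullet> (\<chi> i. v $ \<iota> i)"
    using \<iota> by (simp add: sum.reindex row_coords_on_def inner_vec_def)
  finally show ?thesis .
qed

lemma det_frame_replace_rows:
  fixes \<iota> :: "'k::finite \<Rightarrow> 'n"
  assumes det: "det (frame j0 f) \<noteq> 0" and \<iota>: "inj \<iota>" and j0: "j0 \<notin> range \<iota>"
  shows "det (frame j0 (\<lambda>r. if r \<in> range \<iota> then g (inv \<iota> r) else f r))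
    = det (\<chi> i. row_coords_on \<iota> j0 f (g i)) * det (frame j0 f)"
proof -
  let ?M = "frame j0 f" and ?f = "\<lambda>r. if r \<in> range \<iota> then g (inv \<iota> r) else f r"
  define B where "B = (\<chi> r. if r \<in> range \<iota> then row_coords j0 f $ g (inv \<iota> r) else axis r 1)"
  have coords: "row_coords j0 f ** ?M = A"
    by (simp add: row_coords_def matrix_mul_assoc[symmetric] matrix_inv_frame[OF det])
  have "(B ** ?M) $ r = frame j0 ?f $ r" for r
  proof (cases "r \<in> range \<iota>")
    case True
    then have "(B ** ?M) $ r = (row_coords j0 f ** ?M) $ g (inv \<iota> r)"
      by (simp add: B_def matrix_matrix_mult_def)
    also have "\<dots> = A $ g (inv \<iota> r)" by (simp only: coords)
    also have "r \<noteq> j0" using True j0 by blast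
    then have "A $ g (inv \<iota> r) = frame j0 ?f $ r" using True by (simp add: frame_def)
    finally show ?thesis .
  next
    case False
    then have "(B ** ?M) $ r = (mat 1 ** ?M) $ r"
      by (simp add: B_def matrix_matrix_mult_def mat_def axis_def eq_commute)
    then show ?thesis using False by (simp add: frame_def)
  qed
  then have "frame j0 ?f = B ** ?M" by (simp add: vec_eq_iff)
  moreover have "det B = det (\<chi> i j. B $ \<iota> i $ \<iota> j)"
    using \<iota> by (rule det_block_identity) (simp add: B_def)
  moreover have "(\<chi> i j. B $ \<iota> i $ \<iota> j) = (\<chi> i. row_coords_on \<iota> j0 f (g i))"
    using \<iota> by (simp add: B_def row_coords_on_def vec_eq_iff)
  ultimately show ?thesis by (simp add: det_mul)
qed

lemma nonsingular_frame_exists: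
  assumes rank: "rank A = CARD('n)" and \<alpha>: "\<alpha> \<bullet> w \<noteq> 0" and j0: "j0 \<notin> F"
    and w: "face_dim (rows A) w \<le> card F + 1"
  shows "\<exists>f. (\<forall>i. i \<noteq> j0 \<longrightarrow> i \<notin> F \<longrightarrow> A $ f i \<bullet> w = 0) \<and> det (frame j0 f) \<noteq> 0"
proof -
  let ?C = "- insert j0 F"
  have "card (insert j0 F) = card F + 1" using j0 by simp
  then have C: "card ?C + (card F + 1) = CARD('n)"
    using card_mono[of UNIV "insert j0 F"] by (simp add: Compl_eq_Diff_UNIV card_Diff_subset)
  have dim: "dim (rows A) = DIM(real^'n)" using rank by (simp add: row_rank_def)
  have "card ?C \<le> dim (annihilators (rows A) w)" using w C by (simp add: face_dim_le_iff)
  then obtain B0 where B0: "B0 \<subseteq> annihilators (rows A) w" "independent B0" "card B0 = card ?C"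
    by (rule independent_subset_with_card)
  obtain B where B: "insert \<alpha> B0 \<subseteq> B" "B \<subseteq> insert \<alpha> (rows A)" "independent B" "span B = UNIV"
    using extend_annihilators_to_basis[OF dim \<alpha> B0(1,2)] by blast
  have "finite B" "card B = CARD('n)"
    using B(3) dim_eq_card_independent[OF B(3)] dim_span[of B] B(4)
    by (auto simp: independent_imp_finite simp del: dim_span)
  moreover have "\<alpha> \<notin> B0" using \<alpha> B0(1) by (auto simp: annihilators_def)
  ultimately obtain h where h: "bij_betw h (UNIV - {j0}) (B - {\<alpha>})" "h ` ?C = B0"
    using bij_betw_matching_subsets[of "UNIV - {j0}" "B - {\<alpha>}" ?C B0] B(1) B0(3) by auto
  have "h i \<in> range (($) A)" if "i \<noteq> j0" for i
    using bij_betwE[OF h(1)] B(2) that unfolding rows_eq_range by blast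
  then have "\<forall>i. \<exists>k. i \<noteq> j0 \<longrightarrow> A $ k = h i" by (metis imageE)
  then obtain f where f: "\<And>i. i \<noteq> j0 \<Longrightarrow> A $ f i = h i" by metis
  have "A $ f i \<bullet> w = 0" if "i \<noteq> j0" "i \<notin> F" for i
    using that f h(2) B0(1) by (auto simp: annihilators_def)
  moreover have "B \<subseteq> rows (frame j0 f)"
  proof -
    have "\<alpha> = frame j0 f $ j0" "\<And>i. i \<noteq> j0 \<Longrightarrow> h i = frame j0 f $ i" using f by (simp_all add: frame_def)
    moreover have "B \<subseteq> insert \<alpha> (h ` (UNIV - {j0}))" using bij_betw_imp_surj_on[OF h(1)] by blast
    ultimately show ?thesis unfolding rows_eq_range by blast
  qed
  then have "span (rows (frame j0 f)) = UNIV" using B(4) span_mono by blast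
  then have "det (frame j0 f) \<noteq> 0" by (rule det_nonzero_if_span_rows)
  ultimately show ?thesis by blast
qed

lemma maximal_frame_exists:
  assumes "rank A = CARD('n)" "\<alpha> \<bullet> w \<noteq> 0" "j0 \<notin> F" "face_dim (rows A) w \<le> card F + 1"
  obtains f where "\<And>i. i \<noteq> j0 \<Longrightarrow> i \<notin> F \<Longrightarrow> A $ f i \<bullet> w = 0" "det (frame j0 f) \<noteq> 0"
    "\<And>f'. (\<And>i. i \<notin> F \<Longrightarrow> f' i = f i) \<Longrightarrow> \<bar>det (frame j0 f')\<bar> \<le> \<bar>det (frame j0 f)\<bar>"
proof -
  let ?S = "{f. \<forall>i. i \<noteq> j0 \<longrightarrow> i \<notin> F \<longrightarrow> A $ f i \<bullet> w = 0}"
  obtain f0 where f0: "f0 \<in> ?S" "det (frame j0 f0) \<noteq> 0"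
    using nonsingular_frame_exists[OF assms] by blast
  then obtain f where f: "f \<in> ?S" "\<And>f'. f' \<in> ?S \<Longrightarrow> \<bar>det (frame j0 f')\<bar> \<le> \<bar>det (frame j0 f)\<bar>"
    using ex_is_arg_min_if_finite[of ?S "\<lambda>f. - \<bar>det (frame j0 f)\<bar>"] by (auto simp: is_arg_min_linorder)
  show ?thesis
  proof (rule that)
    show "det (frame j0 f) \<noteq> 0" using f(2)[OF f0(1)] f0(2) by auto
    show "\<bar>det (frame j0 f')\<bar> \<le> \<bar>det (frame j0 f)\<bar>" if "\<And>i. i \<notin> F \<Longrightarrow> f' i = f i" for f'
      using f(1) that by (intro f(2)) auto
  qed (use f in auto)
qed

lemma det_bounded_row_coords:
  fixes \<iota> :: "'k::finite \<Rightarrow> 'n"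
  assumes \<iota>: "inj \<iota>" "j0 \<notin> range \<iota>" and det: "det (frame j0 f) \<noteq> 0"
    and max: "\<And>f'. (\<And>i. i \<notin> range \<iota> \<Longrightarrow> f' i = f i) \<Longrightarrow> \<bar>det (frame j0 f')\<bar> \<le> \<bar>det (frame j0 f)\<bar>"
  shows "det_bounded_system (symmetrized (range (row_coords_on \<iota> j0 f)))"
proof (rule det_bounded_system_symmetrized)
  have "\<iota> i \<noteq> j0" for i using \<iota>(2) by blast
  then have "row_coords_on \<iota> j0 f (f (\<iota> i)) = axis i 1" for i
    using row_coords_frame_row[OF det] \<iota>(1) by (auto simp: row_coords_on_def vec_eq_iff axis_def inj_eq)
  then show "axis i 1 \<in> range (row_coords_on \<iota> j0 f)" for i by (metis rangeI)
  show "\<bar>det (\<chi> i. row_coords_on \<iota> j0 f (g i))\<bar> \<le> 1" for g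
  proof -
    have "\<bar>det (\<chi> i. row_coords_on \<iota> j0 f (g i)) * det (frame j0 f)\<bar> \<le> 1 * \<bar>det (frame j0 f)\<bar>"
      unfolding det_frame_replace_rows[OF det \<iota>, symmetric] by (simp add: max)
    then show ?thesis using det by (simp add: abs_mult)
  qed
qed

lemma Delta_alpha_pos:
  assumes "rank A = CARD('n)" "\<alpha> \<noteq> 0"
  shows "0 < Delta_alpha \<alpha> A"
proof -
  fix j0 :: 'n
  have "card (UNIV - {j0}) + 1 = CARD('n)" by (simp add: Suc_diff_1[OF zero_less_card_finite])
  then obtain f where "det (frame j0 f) \<noteq> 0"
    using nonsingular_frame_exists[of \<alpha> j0 "UNIV - {j0}"] assms by (auto simp: face_dim_def)
  then show ?thesis using abs_det_frame_le_Delta_alpha[of j0 f] by linarith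
qed

end

section \<open>Volume bounds for lattice-free tubes\<close>

definition tube :: "real^'n^'m \<Rightarrow> real^'n \<Rightarrow> (real^'n) set" where
  "tube A w = {t *\<^sub>R w + y | t y. \<bar>t\<bar> \<le> 1 \<and> (\<forall>k. \<bar>A $ k \<bullet> y\<bar> < 1)}"

definition lattice_free_tube :: "real^'n^'m \<Rightarrow> real^'n \<Rightarrow> bool" where
  "lattice_free_tube A w \<longleftrightarrow> tube A w \<inter> int_lattice \<subseteq> {0}"

locale integral_system = frames A \<alpha> for A :: "real^'n^'m" and \<alpha> :: "real^'n" +
  assumes rows_in_lattice: "A $ k \<in> int_lattice" and full_rank: "rank A = CARD('n)"
    and alpha_in_lattice: "\<alpha> \<in> int_lattice" and alpha_nonzero: "\<alpha> \<noteq> 0"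
begin

lemma frame_row_int: "frame j0 f $ i \<in> int_lattice"
  using rows_in_lattice alpha_in_lattice by (simp add: frame_def)

context
  fixes \<iota> :: "'k::finite \<Rightarrow> 'n" and j0 :: 'n and f :: "'n \<Rightarrow> 'm"
    and w :: "real^'n" and K :: "(real^'k) set"
  assumes det: "det (frame j0 f) \<noteq> 0" and \<iota>: "inj \<iota>" "j0 \<notin> range \<iota>"
    and w: "\<And>i. i \<noteq> j0 \<Longrightarrow> i \<notin> range \<iota> \<Longrightarrow> A $ f i \<bullet> w = 0" "\<alpha> \<bullet> w \<noteq> 0"
    and free: "lattice_free_tube A w"
    and K: "\<And>y y' k. y \<in> K \<Longrightarrow> y' \<in> K \<Longrightarrow> \<bar>row_coords_on \<iota> j0 f k \<bullet> (y - y')\<bar> < 1"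
begin

text \<open>Integrality forces the coordinates of \<open>x - x'\<close> outside the range of \<open>\<iota>\<close> to vanish, which
  places \<open>p\<close> in the tube.\<close>
lemma lattice_point_of_prism_eq_0:
  assumes x: "x \<in> prism \<iota> K" "x' \<in> prism \<iota> K"
    and p: "p \<in> int_lattice" "p = (of_int j / (\<alpha> \<bullet> w)) *\<^sub>R w + matrix_inv (frame j0 f) *v (x - x')"
    and j: "\<bar>of_int j\<bar> \<le> \<bar>\<alpha> \<bullet> w\<bar>"
  shows "p = 0 \<and> j = 0"
proof -
  let ?M = "frame j0 f"
  define t where "t = of_int j / (\<alpha> \<bullet> w)"
  define y where "y = matrix_inv ?M *v (x - x')"
  have frame_inner: "?M $ i \<bullet> y = x $ i - x' $ i" for i
    using frame_row_inner_matrix_inv[OF det, of i "x - x'"] by (simp add: y_def)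
  have p_decomp: "p = t *\<^sub>R w + y" using p(2) by (simp add: t_def y_def)
  have outside_eq_0: "x $ i - x' $ i = 0" if "i \<notin> range \<iota>" for i
  proof (rule Ints_abs_less_1_eq_0)
    have "t * (?M $ i \<bullet> w) \<in> \<int>" using that w by (auto simp: frame_def t_def)
    moreover have "x $ i - x' $ i = ?M $ i \<bullet> p - t * (?M $ i \<bullet> w)"
      using frame_inner[of i] by (simp add: p_decomp inner_add_right)
    ultimately show "x $ i - x' $ i \<in> \<int>" using Ints_inner[OF frame_row_int p(1)] by simp
    have "0 < x $ i" "x $ i < 1" "0 < x' $ i" "x' $ i < 1" using x that by (auto simp: prism_def)
    then show "\<bar>x $ i - x' $ i\<bar> < 1" by linarith
  qed
  have "\<bar>A $ k \<bullet> y\<bar> < 1" for k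
  proof -
    have "A $ k \<bullet> y = row_coords_on \<iota> j0 f k \<bullet> ((\<chi> i. x $ \<iota> i) - (\<chi> i. x' $ \<iota> i))"
      using row_inner_matrix_inv_frame[OF \<iota>(1), of "x - x'" k j0 f] outside_eq_0
      by (simp add: y_def minus_vec_def)
    then show ?thesis using K x by (simp add: prism_def)
  qed
  moreover have "\<bar>t\<bar> \<le> 1" using j w(2) by (simp add: t_def abs_divide divide_le_eq_1)
  ultimately have "p \<in> tube A w" unfolding tube_def p_decomp by blast
  then have "p = 0" using free p(1) unfolding lattice_free_tube_def by blast
  moreover have "\<alpha> \<bullet> p = t * (\<alpha> \<bullet> w) + (x $ j0 - x' $ j0)"
    using frame_inner[of j0] by (simp add: p_decomp inner_add_right frame_def)
  ultimately show ?thesis using outside_eq_0[OF \<iota>(2)] w(2) by (simp add: t_def)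
qed

text \<open>Pigeonhole principle: with \<open>M\<close> the frame, the bodies \<open>M\<inverse> (prism \<iota> K)\<close> shifted by
  \<open>(j / (\<alpha> \<bullet> w)) w\<close>, \<open>0 \<le> j \<le> \<bar>\<alpha> \<bullet> w\<bar>\<close>, overlap modulo the integer lattice as soon as their total
  measure exceeds \<open>1\<close>.\<close>
lemma prism_base_volume_bound:
  assumes K_meas: "open K" "bounded K"
  shows "\<bar>\<alpha> \<bullet> w\<bar> * measure lebesgue K < \<bar>det (frame j0 f)\<bar>"
proof (rule ccontr)
  let ?M = "frame j0 f"
  let ?N = "matrix_inv ?M"
  define Y where "Y = (*v) ?N ` prism \<iota> K"
  define J where "J = nat \<lfloor>\<bar>\<alpha> \<bullet> w\<bar>\<rfloor>"
  assume "\<not> ?thesis"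
  then have large: "\<bar>det ?M\<bar> \<le> \<bar>\<alpha> \<bullet> w\<bar> * measure lebesgue K" by simp
  have Y: "Y \<in> lmeasurable" "measure lebesgue Y = measure lebesgue K / \<bar>det ?M\<bar>"
    unfolding Y_def
    using matrix_inv_image_lebesgue[OF det lmeasurable_prism[OF K_meas]] measure_prism[OF \<iota>(1) K_meas(1)]
    by auto
  have "bounded Y" unfolding Y_def
    by (intro bounded_linear_image bounded_prism K_meas(2) matrix_vector_mul_bounded_linear)
  have J: "real J \<le> \<bar>\<alpha> \<bullet> w\<bar>" "\<bar>\<alpha> \<bullet> w\<bar> < real J + 1" by (auto simp: J_def)
  have "0 < measure lebesgue K"
    using large det
    by (metis abs_ge_zero measure_nonneg mult_zero_right not_less order_le_less zero_less_abs_iff)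
  then have "\<bar>\<alpha> \<bullet> w\<bar> * measure lebesgue K < (real J + 1) * measure lebesgue K" using J(2) by simp
  then have "\<bar>det ?M\<bar> < (real J + 1) * measure lebesgue K" using large by linarith
  then have "1 < (real J + 1) * measure lebesgue Y" using det by (simp add: Y(2) less_divide_eq)
  from lattice_point_in_cylinder[OF Y(1) \<open>bounded Y\<close> this, of "(1 / (\<alpha> \<bullet> w)) *\<^sub>R w"]
  obtain p y y' j where p: "p \<in> int_lattice" and j: "\<bar>j\<bar> \<le> int J" and y: "y \<in> Y" "y' \<in> Y"
    and p_decomp: "p = of_int j *\<^sub>R ((1 / (\<alpha> \<bullet> w)) *\<^sub>R w) + (y - y')" and ne: "(p, j) \<noteq> (0, 0)" .
  obtain x x' where x: "x \<in> prism \<iota> K" "x' \<in> prism \<iota> K" "y = ?N *v x" "y' = ?N *v x'"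
    using y by (auto simp: Y_def)
  have "p = (of_int j / (\<alpha> \<bullet> w)) *\<^sub>R w + ?N *v (x - x')"
    using p_decomp by (simp add: x(3,4) matrix_vector_mult_diff_distrib)
  moreover have "\<bar>of_int j\<bar> \<le> \<bar>\<alpha> \<bullet> w\<bar>" using j J(1) by linarith
  ultimately have "p = 0 \<and> j = 0"
    using lattice_point_of_prism_eq_0[OF x(1,2) p] by blast
  then show False using ne by simp
qed

end

lemma polar_volume_bound:
  fixes v :: real
  assumes k: "CARD('k::finite) < CARD('n)"
    and w: "face_dim (rows A) w \<le> CARD('k) + 1" "lattice_free_tube A w"
    and v: "\<And>G :: (real^'k) set. det_bounded_system G \<Longrightarrow> v \<le> measure lebesgue (open_polar G)"
  shows "\<bar>\<alpha> \<bullet> w\<bar> * v < 2 ^ CARD('k) * Delta_alpha \<alpha> A"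
proof (cases "\<alpha> \<bullet> w = 0")
  case False
  obtain \<iota> :: "'k \<Rightarrow> 'n" where \<iota>: "inj \<iota>" using k card_le_inj[of "UNIV::'k set" "UNIV::'n set"] by auto
  then have card: "card (range \<iota>) = CARD('k)" by (simp add: card_image)
  then obtain j0 where j0: "j0 \<notin> range \<iota>" using k by (metis UNIV_eq_I less_irrefl)
  obtain f where f: "\<And>i. i \<noteq> j0 \<Longrightarrow> i \<notin> range \<iota> \<Longrightarrow> A $ f i \<bullet> w = 0" and det: "det (frame j0 f) \<noteq> 0"
    and max: "\<And>f'. (\<And>i. i \<notin> range \<iota> \<Longrightarrow> f' i = f i) \<Longrightarrow> \<bar>det (frame j0 f')\<bar> \<le> \<bar>det (frame j0 f)\<bar>"
    using maximal_frame_exists[OF full_rank False j0] w(1) card by metis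
  let ?\<kappa> = "row_coords_on \<iota> j0 f"
  let ?G = "symmetrized (range ?\<kappa>)"
  let ?K = "(*\<^sub>R) (1 / 2) ` open_polar ?G"
  have G: "det_bounded_system ?G" using \<iota> j0 det max by (rule det_bounded_row_coords)
  have "\<bar>\<alpha> \<bullet> w\<bar> * measure lebesgue ?K < \<bar>det (frame j0 f)\<bar>"
  proof (rule prism_base_volume_bound[OF det \<iota> j0 f False w(2)])
    show "\<bar>?\<kappa> k \<bullet> (y - y')\<bar> < 1" if "y \<in> ?K" "y' \<in> ?K" for y y' k
      using that by (rule inner_diff_half_open_polar_less_1) simp
    show "open ?K" "bounded ?K"
      using G by (auto intro!: open_scaling bounded_scaling open_open_polar bounded_open_polar
          simp: det_bounded_system_def)
  qed
  moreover have "measure lebesgue ?K = (1 / 2) ^ CARD('k) * measure lebesgue (open_polar ?G)"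
    using measure_lebesgue_affine[of "1 / 2" 0 "open_polar ?G"] by simp
  ultimately have "\<bar>\<alpha> \<bullet> w\<bar> * measure lebesgue (open_polar ?G) < 2 ^ CARD('k) * \<bar>det (frame j0 f)\<bar>"
    by (simp add: power_one_over field_simps)
  moreover have "\<bar>\<alpha> \<bullet> w\<bar> * v \<le> \<bar>\<alpha> \<bullet> w\<bar> * measure lebesgue (open_polar ?G)"
    by (intro mult_left_mono v G) simp
  moreover have "2 ^ CARD('k) * \<bar>det (frame j0 f)\<bar> \<le> 2 ^ CARD('k) * Delta_alpha \<alpha> A"
    by (intro mult_left_mono abs_det_frame_le_Delta_alpha) simp
  ultimately show ?thesis by linarith
qed (simp add: Delta_alpha_pos full_rank alpha_nonzero)

end

section \<open>Proximity of integer and linear optima\<close>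

context integral_system
begin

lemma abs_inner_less_if_face_dim_2:
  assumes "2 \<le> CARD('n)" "face_dim (rows A) w \<le> 2" "lattice_free_tube A w"
  shows "\<bar>\<alpha> \<bullet> w\<bar> < Delta_alpha \<alpha> A"
  using polar_volume_bound[where 'k = 1, of w 2] assms measure_open_polar_ge_2 by simp

lemma abs_inner_less_if_face_dim_3:
  assumes "3 \<le> CARD('n)" "face_dim (rows A) w \<le> 3" "lattice_free_tube A w"
  shows "\<bar>\<alpha> \<bullet> w\<bar> < 4 / 3 * Delta_alpha \<alpha> A"
  using polar_volume_bound[where 'k = 2, of w 3] assms measure_open_polar_ge_3 by simp

lemma abs_inner_less_add_if_face_dim_add:
  assumes "face_dim (rows A) x \<le> k + l"
    and k: "\<And>w. w \<in> spindle (rows A) x \<Longrightarrow> face_dim (rows A) w \<le> k \<Longrightarrow> \<bar>\<alpha> \<bullet> w\<bar> < r"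
    and l: "\<And>w. w \<in> spindle (rows A) x \<Longrightarrow> face_dim (rows A) w \<le> l \<Longrightarrow> \<bar>\<alpha> \<bullet> w\<bar> < s"
  shows "\<bar>\<alpha> \<bullet> x\<bar> < r + s"
proof -
  have "finite (rows A)" "dim (rows A) = DIM(real^'n)"
    using full_rank by (simp_all add: rows_eq_range row_rank_def)
  then obtain w where w: "w \<in> spindle (rows A) x" "face_dim (rows A) w \<le> k"
      "face_dim (rows A) (x - w) \<le> l"
    using assms(1) by (rule spindle_split)
  have "\<bar>\<alpha> \<bullet> w\<bar> < r" "\<bar>\<alpha> \<bullet> (x - w)\<bar> < s" using w by (auto intro: k l spindle_diff)
  then show ?thesis by (simp add: inner_diff_right)
qed

lemma abs_inner_less_if_spindle_tubes_lattice_free: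
  assumes n2: "2 \<le> CARD('n)" and m: "2 \<le> m" "m \<le> CARD('n)" "face_dim (rows A) x \<le> m"
    and free: "\<And>w. w \<in> spindle (rows A) x \<Longrightarrow> lattice_free_tube A w"
  shows "\<bar>\<alpha> \<bullet> x\<bar> < (4 * real m + 2) / 9 * Delta_alpha \<alpha> A"
  using m free
proof (induction m arbitrary: x rule: less_induct)
  case (less m)
  let ?D = "Delta_alpha \<alpha> A"
  note free = less.prems(4)
  have D: "0 < ?D" using full_rank alpha_nonzero by (rule Delta_alpha_pos)
  have two: "\<bar>\<alpha> \<bullet> w\<bar> < ?D" if "w \<in> spindle (rows A) x" "face_dim (rows A) w \<le> 2" for w
    using n2 that by (intro abs_inner_less_if_face_dim_2 free)
  have three: "\<bar>\<alpha> \<bullet> w\<bar> < 4 / 3 * ?D" if "w \<in> spindle (rows A) x" "face_dim (rows A) w \<le> 3" "3 \<le> m" for w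
    using less.prems(2) that by (intro abs_inner_less_if_face_dim_3 free) auto
  consider "m = 2" | "m = 3" | "m = 4" | "5 \<le> m" using less.prems(1) by linarith
  then show ?case
  proof cases
    assume "m = 2"
    then show ?thesis using two[OF spindle_self] less.prems(3) D by simp
  next
    assume "m = 3"
    then have "\<bar>\<alpha> \<bullet> x\<bar> < 4 / 3 * ?D" using three[OF spindle_self] less.prems(3) by simp
    then show ?thesis using D \<open>m = 3\<close> by simp
  next
    assume "m = 4"
    then have "\<bar>\<alpha> \<bullet> x\<bar> < ?D + ?D"
      using less.prems(3) two by (intro abs_inner_less_add_if_face_dim_add[of x 2 2]) auto
    then show ?thesis using \<open>m = 4\<close> by simp
  next
    assume "5 \<le> m"
    have "\<bar>\<alpha> \<bullet> x\<bar> < 4 / 3 * ?D + (4 * real (m - 3) + 2) / 9 * ?D"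
    proof (rule abs_inner_less_add_if_face_dim_add)
      show "face_dim (rows A) x \<le> 3 + (m - 3)" using less.prems(3) \<open>5 \<le> m\<close> by simp
      show "\<bar>\<alpha> \<bullet> w\<bar> < 4 / 3 * ?D" if "w \<in> spindle (rows A) x" "face_dim (rows A) w \<le> 3" for w
        using three that \<open>5 \<le> m\<close> by simp
      show "\<bar>\<alpha> \<bullet> w\<bar> < (4 * real (m - 3) + 2) / 9 * ?D"
        if "w \<in> spindle (rows A) x" "face_dim (rows A) w \<le> m - 3" for w
        using that less.prems(2) \<open>5 \<le> m\<close> by (intro less.IH free) (auto intro: spindle_trans)
    qed
    also have "\<dots> = (4 * real m + 2) / 9 * ?D" using \<open>5 \<le> m\<close> by (simp add: of_nat_diff field_simps)
    finally show ?thesis .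
  qed
qed

end

lemma mem_polyhedron_of: "x \<in> polyhedron_of A b \<longleftrightarrow> (\<forall>k. A $ k \<bullet> x \<le> b $ k)"
  by (simp add: polyhedron_of_def matrix_vector_mul_component)

lemma step_within_slack:
  fixes A :: "real^'n^'m"
  assumes x: "x \<in> polyhedron_of A b" and q: "\<And>k. A $ k \<bullet> x = b $ k \<Longrightarrow> q k \<le> 0"
  obtains s where "0 < s" "\<And>k. s * q k \<le> b $ k - A $ k \<bullet> x"
proof (cases "\<exists>k. 0 < q k")
  case True
  then have "\<exists>k\<in>UNIV. - q k < 0" by auto
  then obtain s where "0 < s" "\<And>k. 0 \<le> b $ k - A $ k \<bullet> x + s * - q k"
    by (rule ratio_test[of UNIV "\<lambda>k. b $ k - A $ k \<bullet> x" "\<lambda>k. - q k", rotated 3])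
       (use x q in \<open>auto simp: mem_polyhedron_of\<close>)
  then show ?thesis using that by (simp add: algebra_simps)
next
  case False
  then have "1 * q k \<le> b $ k - A $ k \<bullet> x" for k
    using x by (auto simp: mem_polyhedron_of not_less intro: order_trans[of _ 0])
  then show ?thesis using that[of 1] by simp
qed

lemma inner_nonneg_if_optimal:
  assumes x: "x \<in> polyhedron_of A b" and opt: "\<And>y. y \<in> polyhedron_of A b \<Longrightarrow> c \<bullet> y \<le> c \<bullet> x"
    and p: "\<And>k. A $ k \<bullet> x = b $ k \<Longrightarrow> 0 \<le> A $ k \<bullet> p"
  shows "0 \<le> c \<bullet> p"
proof -
  obtain s where s: "0 < s" "\<And>k. s * - (A $ k \<bullet> p) \<le> b $ k - A $ k \<bullet> x"
    using step_within_slack[OF x, of "\<lambda>k. - (A $ k \<bullet> p)"] p by auto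
  then have "x - s *\<^sub>R p \<in> polyhedron_of A b"
    by (simp add: mem_polyhedron_of inner_diff_right algebra_simps)
  then have "0 \<le> s * (c \<bullet> p)" using opt by (fastforce simp: inner_diff_right)
  then show ?thesis using s(1) by (simp add: zero_le_mult_iff)
qed

lemma extreme_point_tight_rows_kernel:
  assumes x: "x extreme_point_of polyhedron_of A b" and p: "\<And>k. A $ k \<bullet> x = b $ k \<Longrightarrow> A $ k \<bullet> p = 0"
  shows "p = 0"
proof (rule ccontr)
  assume "p \<noteq> 0"
  have "x \<in> polyhedron_of A b" using x by (simp add: extreme_point_of_def)
  then obtain s where s: "0 < s" "\<And>k. s * \<bar>A $ k \<bullet> p\<bar> \<le> b $ k - A $ k \<bullet> x"
    using step_within_slack[of x A b "\<lambda>k. \<bar>A $ k \<bullet> p\<bar>"] p by auto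
  have "A $ k \<bullet> (x + s *\<^sub>R p) \<le> b $ k \<and> A $ k \<bullet> (x - s *\<^sub>R p) \<le> b $ k" for k
  proof -
    have "\<bar>s * (A $ k \<bullet> p)\<bar> \<le> b $ k - A $ k \<bullet> x" using s by (simp add: abs_mult)
    then show ?thesis unfolding inner_add_right inner_diff_right inner_scaleR_right by linarith
  qed
  then have "x + s *\<^sub>R p \<in> polyhedron_of A b" "x - s *\<^sub>R p \<in> polyhedron_of A b"
    by (simp_all add: mem_polyhedron_of)
  moreover have "x = midpoint (x + s *\<^sub>R p) (x - s *\<^sub>R p)"
    by (simp add: midpoint_def algebra_simps scaleR_2[symmetric])
  moreover have "x + s *\<^sub>R p \<noteq> x - s *\<^sub>R p"
  proof
    assume "x + s *\<^sub>R p = x - s *\<^sub>R p"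
    then have "(2 * s) *\<^sub>R p = 0" by (simp add: algebra_simps scaleR_2[symmetric] flip: scaleR_scaleR)
    then show False using s(1) \<open>p \<noteq> 0\<close> by simp
  qed
  ultimately show False using x unfolding extreme_point_of_def by (metis midpoint_in_open_segment)
qed

lemma Ints_valued_attains_min:
  fixes f :: "'a \<Rightarrow> real"
  assumes "S \<noteq> {}" and int: "\<And>z. z \<in> S \<Longrightarrow> f z \<in> \<int>" and lower: "\<And>z. z \<in> S \<Longrightarrow> L \<le> f z"
  obtains z where "z \<in> S" "\<And>z'. z' \<in> S \<Longrightarrow> f z \<le> f z'"
proof -
  obtain z0 where "z0 \<in> S" using assms(1) by blast
  from ex_has_least_nat[of "\<lambda>z. z \<in> S", OF this, of "\<lambda>z. nat (\<lfloor>f z\<rfloor> - \<lfloor>L\<rfloor>)"]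
  obtain z where z: "z \<in> S" "\<And>z'. z' \<in> S \<Longrightarrow> nat (\<lfloor>f z\<rfloor> - \<lfloor>L\<rfloor>) \<le> nat (\<lfloor>f z'\<rfloor> - \<lfloor>L\<rfloor>)" by blast
  have "f z \<le> f z'" if "z' \<in> S" for z'
  proof -
    have "\<lfloor>L\<rfloor> \<le> \<lfloor>f z'\<rfloor>" using lower[OF that] by (rule floor_mono)
    then have "\<lfloor>f z\<rfloor> \<le> \<lfloor>f z'\<rfloor>" using z(2)[OF that] by linarith
    then show ?thesis using int z(1) that by (metis floor_of_int Ints_cases of_int_le_iff)
  qed
  then show ?thesis using that z(1) by blast
qed

lemma common_denominator:
  fixes c :: "real^'n"
  assumes "\<And>j. c $ j \<in> \<rat>"
  obtains d where "0 < d" "d *\<^sub>R c \<in> int_lattice"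
proof -
  have "\<exists>a b. 0 < b \<and> c $ j = of_int a / of_int b" for j using Rats_cases'[OF assms] by metis
  then obtain a b where b: "\<And>j. 0 < b j" and c: "\<And>j. c $ j = of_int (a j) / of_int (b j)" by metis
  have "of_int (prod b UNIV) * c $ j \<in> \<int>" for j
  proof -
    have "prod b UNIV = b j * prod b (UNIV - {j})" by (simp add: prod.remove)
    then have "of_int (prod b UNIV) * c $ j = of_int (a j * prod b (UNIV - {j}))"
      using b[of j] by (simp add: c)
    then show ?thesis by (metis Ints_of_int)
  qed
  then show ?thesis
    using that[of "of_int (prod b UNIV)"] b by (simp add: int_lattice_def prod_pos del: of_int_prod)
qed

lemma rational_functional_attains_max:
  fixes c :: "real^'n"
  assumes c: "\<And>j. c $ j \<in> \<rat>" and S: "S \<noteq> {}" "S \<subseteq> int_lattice" and bound: "\<And>z. z \<in> S \<Longrightarrow> c \<bullet> z \<le> M"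
  obtains z where "z \<in> S" "\<And>z'. z' \<in> S \<Longrightarrow> c \<bullet> z' \<le> c \<bullet> z"
proof -
  obtain d where d: "0 < d" "d *\<^sub>R c \<in> int_lattice" using common_denominator[OF c] by blast
  obtain z where z: "z \<in> S" "\<And>z'. z' \<in> S \<Longrightarrow> - (d *\<^sub>R c \<bullet> z) \<le> - (d *\<^sub>R c \<bullet> z')"
  proof (rule Ints_valued_attains_min[of S "\<lambda>z. - (d *\<^sub>R c \<bullet> z)" "- (d * M)"])
    show "- (d *\<^sub>R c \<bullet> z) \<in> \<int>" if "z \<in> S" for z
      using S(2) that Ints_inner[OF d(2)] by (auto simp del: inner_scaleR_left)
    show "- (d * M) \<le> - (d *\<^sub>R c \<bullet> z)" if "z \<in> S" for z
      using bound[OF that] d(1) by simp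
  qed (use S(1) in auto)
  then show ?thesis using that d(1) by (metis inner_scaleR_left mult_le_cancel_left_pos neg_le_iff_le)
qed

definition integer_optima :: "real^'n^'m \<Rightarrow> real^'m \<Rightarrow> real^'n \<Rightarrow> (real^'n) set" where
  "integer_optima A b c = {z \<in> polyhedron_of A b \<inter> int_lattice.
     \<forall>z'\<in>polyhedron_of A b \<inter> int_lattice. c \<bullet> z' \<le> c \<bullet> z}"

definition tight_slack :: "real^'n^'m \<Rightarrow> real^'m \<Rightarrow> real^'n \<Rightarrow> real^'n \<Rightarrow> real" where
  "tight_slack A b x z = (\<Sum>k | A $ k \<bullet> x = b $ k. b $ k - A $ k \<bullet> z)"

lemma integer_optimum_with_least_tight_slack:
  fixes A :: "real^'n^'m"
  assumes A: "\<And>k. A $ k \<in> int_lattice" and b: "b \<in> int_lattice" and c: "\<And>j. c $ j \<in> \<rat>"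
    and bound: "\<And>y. y \<in> polyhedron_of A b \<Longrightarrow> c \<bullet> y \<le> M"
    and feasible: "polyhedron_of A b \<inter> int_lattice \<noteq> {}"
  obtains z where "z \<in> integer_optima A b c"
    "\<And>z'. z' \<in> integer_optima A b c \<Longrightarrow> tight_slack A b x z \<le> tight_slack A b x z'"
proof (rule Ints_valued_attains_min)
  obtain z where "z \<in> polyhedron_of A b \<inter> int_lattice"
      "\<And>z'. z' \<in> polyhedron_of A b \<inter> int_lattice \<Longrightarrow> c \<bullet> z' \<le> c \<bullet> z"
    using rational_functional_attains_max[OF c feasible Int_lower2, of M] bound by blast
  then have "z \<in> integer_optima A b c" by (simp add: integer_optima_def)
  then show "integer_optima A b c \<noteq> {}" by blast
  fix z assume "z \<in> integer_optima A b c"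
  then have z: "z \<in> polyhedron_of A b" "z \<in> int_lattice" by (auto simp: integer_optima_def)
  show "tight_slack A b x z \<in> \<int>"
    unfolding tight_slack_def using b z(2) A
    by (intro Ints_sum Ints_diff Ints_inner) (auto simp: int_lattice_def)
  show "0 \<le> tight_slack A b x z"
    unfolding tight_slack_def using z(1) by (intro sum_nonneg) (auto simp: mem_polyhedron_of)
qed (use that in blast)

lemma Ints_near_scaled_segment:
  fixes r :: real
  assumes r: "r \<in> \<int>" "\<bar>r - t * a\<bar> < 1" and t: "0 \<le> t" "t \<le> 1" and a: "a \<in> closed_segment 0 v"
  shows "0 \<le> v \<Longrightarrow> 0 \<le> r \<and> r < v + 1" "v \<le> 0 \<Longrightarrow> r \<le> 0"
proof -
  assume "0 \<le> v"
  then have "0 \<le> a" "a \<le> v" using a by (auto simp: closed_segment_eq_real_ivl)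
  then have ta: "0 \<le> t * a" "t * a \<le> a" using t by (simp_all add: mult_left_le_one_le)
  then have "0 < r + 1" using r(2) by linarith
  with Ints_0 r(1) have "0 \<le> r" by (rule Ints_less_add_1_imp_le)
  then show "0 \<le> r \<and> r < v + 1" using ta \<open>a \<le> v\<close> r(2) by linarith
next
  assume "v \<le> 0"
  then have "a \<le> 0" using a by (auto simp: closed_segment_eq_real_ivl split: if_splits)
  then have "t * a \<le> 0" using t(1) by (rule mult_nonneg_nonpos[rotated])
  then have "r < 0 + 1" using r(2) by linarith
  with r(1) Ints_0 show "r \<le> 0" by (rule Ints_less_add_1_imp_le)
qed

locale least_slack_optimum =
  fixes A :: "real^'n^'m" and b :: "real^'m" and c x z :: "real^'n"
  assumes rows_in_lattice: "A $ k \<in> int_lattice" and rhs_in_lattice: "b \<in> int_lattice"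
    and vertex: "x extreme_point_of polyhedron_of A b"
    and optimal: "y \<in> polyhedron_of A b \<Longrightarrow> c \<bullet> y \<le> c \<bullet> x"
    and integer_optimum: "z \<in> integer_optima A b c"
    and least_slack: "z' \<in> integer_optima A b c \<Longrightarrow> tight_slack A b x z \<le> tight_slack A b x z'"
begin

lemma x_feasible: "x \<in> polyhedron_of A b"
  and z_feasible: "z \<in> polyhedron_of A b \<inter> int_lattice"
  using vertex integer_optimum by (simp_all add: extreme_point_of_def integer_optima_def)

lemma integer_step_in_spindle_tube:
  assumes w: "w \<in> spindle (rows A) (x - z)"
    and p: "p \<in> int_lattice" "p = t *\<^sub>R w + y" "0 \<le> t" "t \<le> 1" "\<And>k. \<bar>A $ k \<bullet> y\<bar> < 1"
  shows "z + p \<in> polyhedron_of A b \<inter> int_lattice" "A $ k \<bullet> x = b $ k \<Longrightarrow> 0 \<le> A $ k \<bullet> p"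
proof -
  have segment: "A $ k \<bullet> w \<in> closed_segment 0 (A $ k \<bullet> (x - z))" for k
    using w by (auto simp: spindle_def rows_eq_range)
  have near: "\<bar>A $ k \<bullet> p - t * (A $ k \<bullet> w)\<bar> < 1" for k using p(2,5) by (simp add: inner_add_right)
  note row_step = Ints_near_scaled_segment[OF Ints_inner[OF rows_in_lattice p(1)] near p(3,4) segment]
  have z_lattice: "z \<in> int_lattice" and Az: "A $ k \<bullet> z \<le> b $ k" and Ax: "A $ k \<bullet> x \<le> b $ k" for k
    using z_feasible x_feasible by (simp_all add: mem_polyhedron_of)
  have "A $ k \<bullet> (z + p) \<le> b $ k" for k
  proof (cases "0 \<le> A $ k \<bullet> (x - z)")
    case True
    then have "A $ k \<bullet> (z + p) < b $ k + 1"
      using row_step(1)[OF True] Ax[of k] unfolding inner_add_right inner_diff_right by linarith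
    moreover have "A $ k \<bullet> (z + p) \<in> \<int>"
      by (intro Ints_inner rows_in_lattice int_lattice_add z_lattice p(1))
    moreover have "b $ k \<in> \<int>" using rhs_in_lattice by (simp add: int_lattice_def)
    ultimately show ?thesis by (intro Ints_less_add_1_imp_le)
  next
    case False
    then show ?thesis using row_step(2)[of k] Az[of k] unfolding inner_add_right by linarith
  qed
  then show "z + p \<in> polyhedron_of A b \<inter> int_lattice"
    using p(1) z_lattice by (simp add: mem_polyhedron_of int_lattice_add)
  show "0 \<le> A $ k \<bullet> p" if "A $ k \<bullet> x = b $ k"
    using row_step(1)[of k] Az[of k] that by (simp add: inner_diff_right)
qed

lemma integer_step_in_spindle_tube_eq_0:
  assumes w: "w \<in> spindle (rows A) (x - z)"
    and p: "p \<in> int_lattice" "p = t *\<^sub>R w + y" "0 \<le> t" "t \<le> 1" "\<And>k. \<bar>A $ k \<bullet> y\<bar> < 1"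
  shows "p = 0"
proof -
  note step = integer_step_in_spindle_tube[OF w p]
  have "0 \<le> c \<bullet> p" using x_feasible optimal step(2) by (rule inner_nonneg_if_optimal)
  moreover have "c \<bullet> (z + p) \<le> c \<bullet> z" using integer_optimum step(1) unfolding integer_optima_def by blast
  ultimately have "c \<bullet> (z + p) = c \<bullet> z" by (simp add: inner_add_right)
  then have "z + p \<in> integer_optima A b c"
    using integer_optimum step(1) by (simp add: integer_optima_def)
  then have "tight_slack A b x z \<le> tight_slack A b x (z + p)" by (rule least_slack)
  then have "(\<Sum>k | A $ k \<bullet> x = b $ k. A $ k \<bullet> p) \<le> 0"
    by (simp add: tight_slack_def inner_add_right sum_subtractf sum.distrib)
  then have "(\<Sum>k | A $ k \<bullet> x = b $ k. A $ k \<bullet> p) = 0" using step(2) by (intro antisym sum_nonneg) auto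
  then have "A $ k \<bullet> p = 0" if "A $ k \<bullet> x = b $ k" for k
    using that step(2) by (subst (asm) sum_nonneg_eq_0_iff) auto
  with vertex show "p = 0" by (rule extreme_point_tight_rows_kernel)
qed

lemma lattice_free_tube_if_in_spindle:
  assumes w: "w \<in> spindle (rows A) (x - z)"
  shows "lattice_free_tube A w"
  unfolding lattice_free_tube_def
proof
  fix p assume p: "p \<in> tube A w \<inter> int_lattice"
  then obtain t y where ty: "p = t *\<^sub>R w + y" "\<bar>t\<bar> \<le> 1" "\<And>k. \<bar>A $ k \<bullet> y\<bar> < 1"
    by (auto simp: tube_def)
  show "p \<in> {0}"
  proof (cases "0 \<le> t")
    case True
    then show ?thesis using integer_step_in_spindle_tube_eq_0[OF w _ ty(1)] p ty by auto
  next
    case False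
    have "- p \<in> int_lattice" using p by (simp add: int_lattice_uminus)
    then have "- p = 0"
      by (rule integer_step_in_spindle_tube_eq_0[OF w, of _ "- t" "- y"]) (use False ty in auto)
    then show ?thesis by simp
  qed
qed

end

theorem theorem5:
  fixes A :: "real^'n^'m" and \<alpha> :: "real^'n" and b :: "real^'m" and c :: "real^'n"
    and xstar :: "real^'n"
  assumes n2: "CARD('n) \<ge> 2"
    and A_int: "\<forall>i j. A $ i $ j \<in> \<int>"
    and A_rank: "rank A = CARD('n)"
    and alpha_int: "\<forall>j. \<alpha> $ j \<in> \<int>"
    and alpha_nz: "\<alpha> \<noteq> 0"
    and b_int: "\<forall>i. b $ i \<in> \<int>"
    and c_rat: "\<forall>j. c $ j \<in> \<rat>"
    and x_vertex: "xstar extreme_point_of (polyhedron_of A b)"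
    and x_opt: "\<forall>y \<in> polyhedron_of A b. c \<bullet> y \<le> c \<bullet> xstar"
    and ip_feasible: "\<exists>z \<in> polyhedron_of A b. \<forall>j. z $ j \<in> \<int>"
  shows "\<exists>zstar \<in> polyhedron_of A b. (\<forall>j. zstar $ j \<in> \<int>)
           \<and> (\<forall>z \<in> polyhedron_of A b. (\<forall>j. z $ j \<in> \<int>) \<longrightarrow> c \<bullet> z \<le> c \<bullet> zstar)
           \<and> \<bar>\<alpha> \<bullet> (xstar - zstar)\<bar> < (4 * real CARD('n) + 2) / 9 * Delta_alpha \<alpha> A"
proof -
  interpret integral_system A \<alpha>
    by standard (use A_int A_rank alpha_int alpha_nz in \<open>auto simp: int_lattice_def\<close>)
  have b: "b \<in> int_lattice" using b_int by (simp add: int_lattice_def)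
  obtain z where z: "z \<in> integer_optima A b c"
    and least: "\<And>z'. z' \<in> integer_optima A b c \<Longrightarrow> tight_slack A b xstar z \<le> tight_slack A b xstar z'"
    using integer_optimum_with_least_tight_slack[OF rows_in_lattice b, of c "c \<bullet> xstar" xstar]
      c_rat x_opt ip_feasible
    by (auto simp: int_lattice_def)
  interpret least_slack_optimum A b c xstar z
    by standard (use b x_vertex x_opt z least in \<open>auto intro: rows_in_lattice\<close>)
  have "\<bar>\<alpha> \<bullet> (xstar - z)\<bar> < (4 * real CARD('n) + 2) / 9 * Delta_alpha \<alpha> A"
    using n2
    by (intro abs_inner_less_if_spindle_tubes_lattice_free lattice_free_tube_if_in_spindle)
       (auto simp: face_dim_def)
  with z show ?thesis by (auto simp: integer_optima_def int_lattice_def)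
qed

end
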